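(* Let $\mathcal A=\mathbb{C}A_n/I_D$ for a Dyck path $D$ of length $n$. The face lattice of the polytope $P_{\mathcal A}$ is isomorphic to the poset of boundary strata of $(U_{\mathcal A})_{\ge0}$.
   Context: **Dyck paths and algebras.** A Dyck path $D$ of length $n$ is a lattice path from $(1,0)$ to $(n+1,n)$ with up steps $(i,j)\to(i,j+1)$ and down steps $(i,j)\to(i+1,j)$, all of whose vertices satisfy $j\ge i-1$. Its up steps are labelled in order $(1),\dots,(n)$ and its down steps in order $(\Sigma 1),\dots,(\Sigma n)$; the down step $(\Sigma i)$ goes from $(i,k_i)$ to $(i+1,k_i)$. A point $(i,j)$, $1\le i\le j\le n$, is on or below $D$ iff $j\le k_i$. $\mathbb{C}A_n$ is the path algebra of $1\leftarrow2\leftarrow\cdots\leftarrow n$ with arrows $\alpha_i:i+1\to i$. $I_D$ is the two-sided ideal generated by the paths $\alpha_b\alpha_{b-1}\cdots\alpha_{a-1}$ (from $b+1$ to $a-1$) for all valleys $(a,b)$ of $D$ (vertices preceded by a down step and followed by an up step). The indecomposable $\mathcal A$-modules are labelled $M_{i,j}$ for the points $(i,j)$, $1\le i\le j\le n$, on or below $D$. **Index set.** $\mathcal I_{\mathcal A}$ consists of the $2n$ steps $(i),(\Sigma i)$ of $D$ together with the diamonds below $D$: a diamond is labelled by its top corner $(i,j)$, $1\le i<j\le n$ (its other corners are $(i,j-1),(i+1,j),(i+1,j-1)$), and it is below $D$ iff $(i,j)$ is on or below $D$. **Compatibility** of $X,Y\in\mathcal I_{\mathcal A}$: (a) $(i,j)$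 and $(k,l)$ are compatible iff the intervals $[i,j],[k,l]$ are comparable under inclusion or disjoint; (b) $(i,j)$ and $(k)$ are compatible iff $k<i$ or $j\le k$; (c) $(i,j)$ and $(\Sigma k)$ are compatible iff $k\le i$ or $j<k$; (d) $(i)$ and $(\Sigma j)$ are compatible iff $i<j$ or the down step $(\Sigma j)$ comes before the up step $(i)$ in $D$; (e) two up steps are always compatible, and two down steps are always compatible. **Configuration space.** $U_{\mathcal A}\subset\mathbb{C}^{\mathcal I_{\mathcal A}}$ is the affine variety cut out by $u_X+\prod_{Y\text{ incompatible with }X}u_Y=1$ for all $X\in\mathcal I_{\mathcal A}$. Its nonnegative part is $(U_{\mathcal A})_{\ge0}=U_{\mathcal A}\cap(\mathbb{R}_{\ge0})^{\mathcal I_{\mathcal A}}$. Its boundary strata are the intersections $(U_{\mathcal A})_{\ge0}\cap\{u_X=0\ \forall X\in S\}$ with $S\subseteq\mathcal I_{\mathcal A}$ ($S=\emptyset$ giving the whole of $(U_{\mathcal A})_{\ge0}$), ordered by inclusion; the empty intersection corresponds to the empty face. **Polytope.** For $1\le i\le j\le n$, $F_{i,j}=1+y_i+y_iy_{i+1}+\cdots+y_iy_{i+1}\cdots y_j$, and $P_{\mathcal A}=\sum\mathrm{Newt}(F_{i,j})\subset\mathbb{R}^n$ is the Minkowski sum of Newton polytopes over all $(i,j)$, $1\le i\le j\le n$, on or below $D$, i.e. over all indecomposable $\mathcal A$-modules $M_{i,j}$. *)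

theory Defs
  imports "HOL-Analysis.Analysis" "HOL-Library.Poly_Mapping" "HOL-Library.Set_Algebras"
begin

section \<open>Dyck paths\<close>

datatype step = Up | Down

text \<open>The vertex reached after the first \<open>p\<close> steps of a path starting at \<open>(1,0)\<close>.\<close>

definition vertex :: "step list \<Rightarrow> nat \<Rightarrow> nat \<times> nat" where
  "vertex D p = (1 + count_list (take p D) Down, count_list (take p D) Up)"

text \<open>The condition \<open>j \<ge> i - 1\<close> on a vertex \<open>(i, j)\<close> is written without subtraction.\<close>

definition dyck_path :: "nat \<Rightarrow> step list \<Rightarrow> bool" where
  "dyck_path n D \<longleftrightarrow>
     vertex D (length D) = (n + 1, n) \<and>
     (\<forall>p\<le>length D. case vertex D p of (i, j) \<Rightarrow> i \<le> j + 1)"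

text \<open>
  Positions in the list \<open>D\<close> (counted from 0) of the up step \<open>(i)\<close> and of the down step
  \<open>(\<Sigma> i)\<close>, for \<open>1 \<le> i \<le> n\<close>; a step in position \<open>p\<close> starts at \<open>vertex D p\<close>.
\<close>

definition up_pos :: "step list \<Rightarrow> nat \<Rightarrow> nat" where
  "up_pos D i = filter (\<lambda>p. D ! p = Up) [0..<length D] ! (i - 1)"

definition down_pos :: "step list \<Rightarrow> nat \<Rightarrow> nat" where
  "down_pos D i = filter (\<lambda>p. D ! p = Down) [0..<length D] ! (i - 1)"

definition down_height :: "step list \<Rightarrow> nat \<Rightarrow> nat" where
  "down_height D i = snd (vertex D (down_pos D i))"

definition points_below :: "nat \<Rightarrow> step list \<Rightarrow> (nat \<times> nat) set" where
  "points_below n D = {(i, j). 1 \<le> i \<and> i \<le> j \<and> j \<le> n \<and> j \<le> down_height D i}"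


section \<open>The index set and compatibility\<close>

datatype index = UpStep nat | DownStep nat | Diamond nat nat

definition index_set :: "nat \<Rightarrow> step list \<Rightarrow> index set" where
  "index_set n D =
     UpStep ` {1..n} \<union> DownStep ` {1..n} \<union>
     {Diamond i j | i j. (i, j) \<in> points_below n D \<and> i < j}"

fun compatible :: "step list \<Rightarrow> index \<Rightarrow> index \<Rightarrow> bool" where
  "compatible D (Diamond i j) (Diamond k l) \<longleftrightarrow>
     {i..j} \<subseteq> {k..l} \<or> {k..l} \<subseteq> {i..j} \<or> {i..j} \<inter> {k..l} = {}"
| "compatible D (Diamond i j) (UpStep k) \<longleftrightarrow> k < i \<or> j \<le> k"
| "compatible D (UpStep k) (Diamond i j) \<longleftrightarrow> k < i \<or> j \<le> k"
| "compatible D (Diamond i j) (DownStep k) \<longleftrightarrow> k \<le> i \<or> j < k"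
| "compatible D (DownStep k) (Diamond i j) \<longleftrightarrow> k \<le> i \<or> j < k"
| "compatible D (UpStep i) (DownStep j) \<longleftrightarrow> i < j \<or> down_pos D j < up_pos D i"
| "compatible D (DownStep j) (UpStep i) \<longleftrightarrow> i < j \<or> down_pos D j < up_pos D i"
| "compatible D (UpStep i) (UpStep j) \<longleftrightarrow> True"
| "compatible D (DownStep i) (DownStep j) \<longleftrightarrow> True"


section \<open>The configuration space\<close>

text \<open>
  Points of \<open>\<complex>\<^sup>I\<close> are the extensional functions on \<open>I\<close>, so that each point is represented by
  exactly one function and inclusion of subsets has its usual meaning.
\<close>

definition config_space :: "nat \<Rightarrow> step list \<Rightarrow> (index \<Rightarrow> complex) set" where
  "config_space n D =
     {u \<in> index_set n D \<rightarrow>\<^sub>E UNIV.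
        \<forall>X\<in>index_set n D. u X + (\<Prod>Y\<in>{Y \<in> index_set n D. \<not> compatible D X Y}. u Y) = 1}"

definition config_space_nonneg :: "nat \<Rightarrow> step list \<Rightarrow> (index \<Rightarrow> complex) set" where
  "config_space_nonneg n D = config_space n D \<inter> (index_set n D \<rightarrow>\<^sub>E \<real>\<^sub>\<ge>\<^sub>0)"

definition boundary_stratum :: "nat \<Rightarrow> step list \<Rightarrow> index set \<Rightarrow> (index \<Rightarrow> complex) set" where
  "boundary_stratum n D S = config_space_nonneg n D \<inter> {u. \<forall>X\<in>S. u X = 0}"

definition boundary_strata :: "nat \<Rightarrow> step list \<Rightarrow> (index \<Rightarrow> complex) set set" where
  "boundary_strata n D = boundary_stratum n D ` Pow (index_set n D)"


section \<open>The polytope\<close>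

text \<open>
  Polynomials in the variables \<open>y\<^sub>1, y\<^sub>2, \<dots>\<close> are finitely supported maps from exponents
  to coefficients, with convolution as multiplication.
\<close>

definition var :: "nat \<Rightarrow> (nat \<Rightarrow>\<^sub>0 nat) \<Rightarrow>\<^sub>0 int" where
  "var i = Poly_Mapping.single (Poly_Mapping.single i 1) 1"

definition F_poly :: "nat \<Rightarrow> nat \<Rightarrow> (nat \<Rightarrow>\<^sub>0 nat) \<Rightarrow>\<^sub>0 int" where
  "F_poly i j = 1 + (\<Sum>k=i..j. \<Prod>m=i..k. var m)"

text \<open>
  \<open>\<real>\<^sup>n\<close> is \<open>real ^ 'n\<close> for a linearly ordered index type with \<open>n\<close> elements; \<open>coord_number\<close> is
  the order isomorphism from that type onto \<open>{1..n}\<close>.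
\<close>

definition coord_number :: "'n::{finite,linorder} \<Rightarrow> nat" where
  "coord_number a = card {..a}"

definition exponent_vector :: "(nat \<Rightarrow>\<^sub>0 nat) \<Rightarrow> real ^ 'n::{finite,linorder}" where
  "exponent_vector e = (\<chi> a. real (Poly_Mapping.lookup e (coord_number a)))"

definition Newt :: "((nat \<Rightarrow>\<^sub>0 nat) \<Rightarrow>\<^sub>0 int) \<Rightarrow> (real ^ 'n::{finite,linorder}) set" where
  "Newt p = convex hull (exponent_vector ` Poly_Mapping.keys p)"

text \<open>The sum is the Minkowski sum of sets.\<close>

definition P_polytope :: "step list \<Rightarrow> (real ^ 'n::{finite,linorder}) set" where
  "P_polytope D = (\<Sum>(i, j)\<in>points_below CARD('n) D. Newt (F_poly i j))"


section \<open>Isomorphism of posets\<close>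

definition order_isomorphic :: "'a::order set \<Rightarrow> 'b::order set \<Rightarrow> bool" where
  "order_isomorphic A B \<longleftrightarrow>
     (\<exists>\<phi>. bij_betw \<phi> A B \<and> (\<forall>x\<in>A. \<forall>y\<in>A. x \<le> y \<longleftrightarrow> \<phi> x \<le> \<phi> y))"

end

theory Submission
  imports Defs
begin

text \<open>
  The idea is to read a nonnegative solution \<open>u\<close> as a compatible family of probability
  distributions. On the open part one may put \<open>y\<^sub>k = z\<^sub>k / z\<^sub>k\<^sub>-\<^sub>1\<close> with positive
  \<open>z\<^sub>0, \<dots>, z\<^sub>n\<close>, and then \<open>F\<^sub>i\<^sub>j = (z\<^sub>i\<^sub>-\<^sub>1 + \<dots> + z\<^sub>j) / z\<^sub>i\<^sub>-\<^sub>1\<close>.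
  So \<open>Newt(F\<^sub>i\<^sub>j)\<close> is a simplex with one corner for each \<open>t \<in> {i - 1..j}\<close>, and a point
  \<open>(i, j)\<close> below \<open>D\<close> stands for the distribution on \<open>{i - 1..j}\<close> that gives \<open>t\<close> a weight
  proportional to \<open>z\<^sub>t\<close>. Write \<open>Z[a..b] = z\<^sub>a + \<dots> + z\<^sub>b\<close>. The variable of a diamond is
  \<open>Z[i-1..j] Z[i..j-1] / (Z[i-1..j-1] Z[i..j])\<close>, the variable of the up step \<open>(j)\<close> is
  \<open>Z[i-1..j-1] / Z[i-1..j]\<close> for the leftmost \<open>i\<close> with \<open>(i, j)\<close> below \<open>D\<close>, and that of the down
  step \<open>(\<Sigma> i)\<close> is \<open>Z[i..j] / Z[i-1..j]\<close> for the topmost such \<open>j\<close>. Products of these variables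
  along a row or a column of the region below \<open>D\<close> telescope to the probabilities of avoiding
  the right or the left end of an interval (\<open>not_right\<close>, \<open>not_left\<close>). The products in
  the defining equations factor into such probabilities, because the labels
  incompatible with a given one are a disjoint union of strips along rows and columns.

  Nothing is divided in passing from \<open>u\<close> to the distributions \<open>interval_prob u i j\<close>, so this makes
  sense also on the boundary, where the equations still force total mass one
  (\<open>complement_identities\<close>, \<open>interval_prob_sum\<close>). Averaging the corners of each simplex with these
  weights and adding up gives a moment map from the nonnegative part to the polytope, and the
  isomorphism sends a face \<open>G\<close> to the set of \<open>u\<close> whose moment lies in \<open>G\<close>. Three facts make this work.

  \<^item> A nonempty face consists of the points maximizing a linear functional. Such functionals
    are height functions \<open>h\<close> on \<open>{0..n}\<close>, and a weighted sum of corners is maximal iff every weight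
    sits where \<open>h\<close> is maximal on its interval (\<open>face_of_heights\<close>, \<open>heights_of_face\<close>).

  \<^item> Each label \<open>X\<close> has a height function whose face is exactly the locus \<open>u\<^sub>X = 0\<close>
    (\<open>supported_low_set_iff\<close>). Hence each stratum comes from an intersection of faces.

  \<^item> For each height function \<open>h\<close> there is a solution whose distributions are uniform on the
    maximizers of \<open>h\<close> (\<open>solution_limit_solution\<close>, \<open>limit_solution_prob\<close>); it is the limit of
    \<open>z\<^sub>t = exp (s h\<^sub>t)\<close> for \<open>s \<rightarrow> \<infinity>\<close>. So each face is recovered from its
    solutions. As the distributions are monomials in \<open>u\<close>, their supports depend only on the zero set of
    \<open>u\<close> (\<open>interval_prob_zero_mono\<close>), and therefore the solutions over a face form the stratum
    given by the zero set of the solution attached to its \<open>h\<close>.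
\<close>


section \<open>Steps and heights of a Dyck path\<close>

text \<open>
  Positions of steps are indices into a filtered list. What is needed of the position \<open>p\<close> of the
  \<open>i\<close>-th step of a kind is only that exactly \<open>i - 1\<close> steps of this kind come before it.
\<close>

lemma nth_filter_upt:
  assumes "i < length (filter P [0..<N])"
  defines "p \<equiv> filter P [0..<N] ! i"
  shows "p < N" "P p" "length (filter P [0..<p]) = i"
proof -
  have "p \<in> set (filter P [0..<N])" unfolding p_def using assms(1) by (rule nth_mem)
  then show p: "p < N" "P p" by auto
  let ?xs = "filter P [0..<p]"
  have "filter P [0..<N] = ?xs @ p # filter P [Suc p..<N]"
    using p upt_add_eq_append[of 0 p "N - p"] by (simp add: upt_conv_Cons)
  then have "filter P [0..<N] ! length ?xs = p" "length ?xs < length (filter P [0..<N])"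
    by (simp_all add: nth_append)
  moreover have "distinct (filter P [0..<N])" by simp
  ultimately show "length ?xs = i"
    using assms(1) nth_eq_iff_index_eq p_def by blast
qed

lemma count_list_take:
  "p \<le> length D \<Longrightarrow> count_list (take p D) s = length (filter (\<lambda>q. D ! q = s) [0..<p])"
  by (induction p) (auto simp: take_Suc_conv_app_nth)

lemma step_position:
  assumes "1 \<le> i" "i \<le> count_list D s"
  defines "p \<equiv> filter (\<lambda>p. D ! p = s) [0..<length D] ! (i - 1)"
  shows "p < length D" "D ! p = s" "count_list (take p D) s = i - 1"
proof -
  have "i - 1 < length (filter (\<lambda>p. D ! p = s) [0..<length D])"
    using assms(1,2) count_list_take[of "length D" D s] by simp
  note * = nth_filter_upt[OF this, folded p_def]
  from * show "p < length D" "D ! p = s" "count_list (take p D) s = i - 1"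
    by (simp_all add: count_list_take)
qed

lemma count_list_take_mono:
  assumes "p \<le> q" shows "count_list (take p D) s \<le> count_list (take q D) s"
proof -
  have "take q D = take p D @ drop p (take q D)"
    using assms by (metis append_take_drop_id min.absorb1 take_take)
  then show ?thesis by (metis count_list_append le_add1)
qed

lemma count_list_take_less:
  assumes "p < q" "p < length D" "D ! p = s"
  shows "count_list (take p D) s < count_list (take q D) s"
  using count_list_take_mono[of "Suc p" q D s] assms by (auto simp: take_Suc_conv_app_nth)

locale dyck =
  fixes n :: nat and D :: "step list"
  assumes dyck: "dyck_path n D"
begin

abbreviation K :: "nat \<Rightarrow> nat" where "K \<equiv> down_height D"

lemma counts: "count_list D Down = n" "count_list D Up = n"
  using dyck by (auto simp: dyck_path_def vertex_def)

lemma down_pos: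
  assumes "1 \<le> i" "i \<le> n"
  shows "down_pos D i < length D" "D ! down_pos D i = Down"
    "count_list (take (down_pos D i) D) Down = i - 1"
    "count_list (take (down_pos D i) D) Up = K i"
  using step_position[of i D Down] assms
  by (simp_all add: down_pos_def counts down_height_def vertex_def)

lemma up_pos:
  assumes "1 \<le> i" "i \<le> n"
  shows "up_pos D i < length D" "D ! up_pos D i = Up"
    "count_list (take (up_pos D i) D) Up = i - 1"
  using step_position[of i D Up] assms by (simp_all add: up_pos_def counts)

text \<open>
  The condition on vertices is used at the end of the down step \<open>(\<Sigma> i)\<close>.
\<close>

lemma height_ge: assumes "1 \<le> i" "i \<le> n" shows "i \<le> K i"
proof -
  let ?p = "Suc (down_pos D i)"
  have "count_list (take ?p D) Down = i" "count_list (take ?p D) Up = K i"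
    using down_pos[OF assms] assms by (simp_all add: take_Suc_conv_app_nth)
  moreover have "?p \<le> length D" using down_pos[OF assms] by simp
  ultimately show ?thesis using dyck by (force simp: dyck_path_def vertex_def)
qed

lemma height_le: assumes "1 \<le> i" "i \<le> n" shows "K i \<le> n"
  using down_pos[OF assms] count_list_take_mono[of "down_pos D i" "length D" D Up] counts by simp

lemma height_mono: assumes "1 \<le> i" "i \<le> j" "j \<le> n" shows "K i \<le> K j"
proof (cases "i = j")
  case False
  have "down_pos D i \<le> down_pos D j"
  proof (rule ccontr)
    assume "\<not> ?thesis"
    then have "count_list (take (down_pos D j) D) Down \<le> count_list (take (down_pos D i) D) Down"
      by (intro count_list_take_mono) simp
    then show False using down_pos(3)[of i] down_pos(3)[of j] assms False by simp
  qed
  then show ?thesis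
    using count_list_take_mono[of "down_pos D i" "down_pos D j" D Up]
      down_pos(4)[of i] down_pos(4)[of j] assms by simp
qed simp

text \<open>
  This turns compatibility of up and down steps into an inequality between heights: together with
  \<open>k \<le> j\<close>, incompatibility of \<open>(j)\<close> and \<open>(\<Sigma> k)\<close> says that \<open>(k, j)\<close> is on or below \<open>D\<close>.
\<close>

lemma down_before_up:
  assumes "1 \<le> k" "k \<le> n" "1 \<le> j" "j \<le> n"
  shows "down_pos D k < up_pos D j \<longleftrightarrow> K k < j"
proof
  assume "down_pos D k < up_pos D j"
  then show "K k < j"
    using count_list_take_mono[of "down_pos D k" "up_pos D j" D Up]
      down_pos(4)[OF assms(1,2)] up_pos(3)[OF assms(3,4)] assms by simp
next
  assume less: "K k < j"
  show "down_pos D k < up_pos D j"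
  proof (rule ccontr)
    assume "\<not> ?thesis"
    moreover have "down_pos D k \<noteq> up_pos D j"
      using down_pos(2)[OF assms(1,2)] up_pos(2)[OF assms(3,4)] by auto
    ultimately have "up_pos D j < down_pos D k" by simp
    from count_list_take_less[OF this up_pos(1,2)[OF assms(3,4)]]
    show False using less down_pos(4)[OF assms(1,2)] up_pos(3)[OF assms(3,4)] by simp
  qed
qed

end

section \<open>Incompatible labels form strips\<close>

context dyck begin

definition point :: "nat \<Rightarrow> nat \<Rightarrow> bool" where
  "point i j \<longleftrightarrow> 1 \<le> i \<and> i \<le> j \<and> i \<le> n \<and> j \<le> K i"

lemma points_below_iff: "(i, j) \<in> points_below n D \<longleftrightarrow> point i j"
  using height_le[of i] by (auto simp: points_below_def point_def)

lemma point_le: "point i j \<Longrightarrow> j \<le> n"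
  using height_le[of i] by (auto simp: point_def)

text \<open>
  The intervals \<open>{i - 1..j}\<close> attached to points below \<open>D\<close> are closed under passing to subintervals with
  at least two elements, so an interval may be shrunk one end at a time.
\<close>

lemma point_subinterval: "point i j \<Longrightarrow> i \<le> i' \<Longrightarrow> i' \<le> j' \<Longrightarrow> j' \<le> j \<Longrightarrow> point i' j'"
  using point_le[of i j] height_mono[of i i'] by (auto simp: point_def)

lemma point_diagonal: "1 \<le> i \<Longrightarrow> i \<le> n \<Longrightarrow> point i i"
  using height_ge by (simp add: point_def)

lemma Diamond_in_index: "Diamond i j \<in> index_set n D \<longleftrightarrow> point i j \<and> i < j"
  by (auto simp: index_set_def points_below_iff)

lemma steps_in_index:
  "UpStep i \<in> index_set n D \<longleftrightarrow> 1 \<le> i \<and> i \<le> n" "DownStep i \<in> index_set n D \<longleftrightarrow> 1 \<le> i \<and> i \<le> n"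
  by (auto simp: index_set_def)

text \<open>
  The up step \<open>(j)\<close> starts at \<open>(first_column j, j - 1)\<close>; so the row \<open>j\<close> of the region below \<open>D\<close>
  extends from this column to the diagonal.
\<close>

definition first_column :: "nat \<Rightarrow> nat" where
  "first_column j = (LEAST i. 1 \<le> i \<and> j \<le> K i)"

lemma first_column:
  assumes "1 \<le> j" "j \<le> n"
  shows "1 \<le> first_column j" "j \<le> K (first_column j)" "first_column j \<le> j"
proof -
  have *: "1 \<le> j \<and> j \<le> K j" using height_ge assms by simp
  show "1 \<le> first_column j" "j \<le> K (first_column j)" "first_column j \<le> j"
    using LeastI[of "\<lambda>i. 1 \<le> i \<and> j \<le> K i", OF *] Least_le[of "\<lambda>i. 1 \<le> i \<and> j \<le> K i", OF *]
    by (auto simp: first_column_def)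
qed

lemma first_column_le_iff:
  assumes "1 \<le> j" "j \<le> n" "1 \<le> i" "i \<le> n"
  shows "first_column j \<le> i \<longleftrightarrow> j \<le> K i"
  using first_column[OF assms(1,2)] height_mono[of "first_column j" i] assms
    Least_le[of "\<lambda>i. 1 \<le> i \<and> j \<le> K i" i] by (auto simp: first_column_def)

lemma point_iff_first_column:
  assumes "1 \<le> j" "j \<le> n" shows "point i j \<longleftrightarrow> first_column j \<le> i \<and> i \<le> j"
  using assms first_column[OF assms] first_column_le_iff[OF assms, of i]
  by (auto simp: point_def)

text \<open>
  The labels met when going from the up step \<open>(j)\<close> to the right along row \<open>j\<close> up to column \<open>i\<close>, or
  from the down step \<open>(\<Sigma> i)\<close> downwards along column \<open>i\<close> to height \<open>j\<close>. A diamond with top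
  corner \<open>(m, l)\<close> lies between the columns \<open>m\<close> and \<open>m + 1\<close> and between the heights \<open>l - 1\<close> and \<open>l\<close>,
  hence the half-open ranges.
\<close>

definition up_strip :: "nat \<Rightarrow> nat \<Rightarrow> index set" where
  "up_strip i j = insert (UpStep j) ((\<lambda>m. Diamond m j) ` {first_column j..<i})"

definition down_strip :: "nat \<Rightarrow> nat \<Rightarrow> index set" where
  "down_strip i j = insert (DownStep i) (Diamond i ` {j<..K i})"

lemma in_up_strip [simp]:
  "UpStep k \<in> up_strip i j \<longleftrightarrow> k = j"
  "DownStep k \<notin> up_strip i j"
  "Diamond k l \<in> up_strip i j \<longleftrightarrow> l = j \<and> first_column j \<le> k \<and> k < i"
  by (auto simp: up_strip_def)

lemma in_down_strip [simp]:
  "UpStep k \<notin> down_strip i j"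
  "DownStep k \<in> down_strip i j \<longleftrightarrow> k = i"
  "Diamond k l \<in> down_strip i j \<longleftrightarrow> k = i \<and> j < l \<and> l \<le> K i"
  by (auto simp: down_strip_def)

lemma strips_disjoint:
  "k \<noteq> l \<Longrightarrow> up_strip i k \<inter> up_strip j l = {}"
  "k \<noteq> l \<Longrightarrow> down_strip k i \<inter> down_strip l j = {}"
  "i \<le> l \<Longrightarrow> up_strip i k \<inter> down_strip l j = {}"
  by (auto simp: up_strip_def down_strip_def)

lemma finite_strips: "finite (up_strip i j)" "finite (down_strip i j)"
  by (simp_all add: up_strip_def down_strip_def)

lemma strips_subset_index:
  assumes "point i j"
  shows "up_strip i j \<subseteq> index_set n D" "down_strip i j \<subseteq> index_set n D"
proof -
  have j: "1 \<le> j" "j \<le> n" using assms point_le[of i j] by (auto simp: point_def)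
  show "up_strip i j \<subseteq> index_set n D"
    using assms j by (auto simp: up_strip_def Diamond_in_index steps_in_index point_iff_first_column)
  show "down_strip i j \<subseteq> index_set n D"
    using assms j by (auto simp: down_strip_def Diamond_in_index steps_in_index point_def)
qed

text \<open>
  In terms of the \<open>z\<^sub>t\<close> these products telescope to \<open>Z[i-1..j-1] / Z[i-1..j]\<close> and
  \<open>Z[i..j] / Z[i-1..j]\<close>: the probabilities that a random element of \<open>{i - 1..j}\<close> is not the right,
  respectively not the left, end of the interval.
\<close>

definition not_right :: "(index \<Rightarrow> 'a::comm_monoid_mult) \<Rightarrow> nat \<Rightarrow> nat \<Rightarrow> 'a" where
  "not_right u i j = prod u (up_strip i j)"

definition not_left :: "(index \<Rightarrow> 'a::comm_monoid_mult) \<Rightarrow> nat \<Rightarrow> nat \<Rightarrow> 'a" where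
  "not_left u i j = prod u (down_strip i j)"

lemma not_right_step:
  assumes "point i j" "i < j"
  shows "not_right u (Suc i) j = not_right u i j * u (Diamond i j)"
proof -
  have "1 \<le> j" "j \<le> n" using assms point_le[of i j] by (auto simp: point_def)
  then have "first_column j \<le> i" using assms by (simp add: point_iff_first_column)
  then have "up_strip (Suc i) j = insert (Diamond i j) (up_strip i j)"
    by (auto simp: up_strip_def atLeastLessThanSuc)
  moreover have "Diamond i j \<notin> up_strip i j" by (auto simp: up_strip_def)
  ultimately show ?thesis by (simp add: not_right_def finite_strips mult.commute)
qed

lemma not_left_step:
  assumes "point i (Suc j)" "i \<le> j"
  shows "not_left u i j = not_left u i (Suc j) * u (Diamond i (Suc j))"
proof -
  have "{j<..K i} = insert (Suc j) {Suc j<..K i}" using assms by (auto simp: point_def)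
  then have "down_strip i j = insert (Diamond i (Suc j)) (down_strip i (Suc j))"
    by (auto simp: down_strip_def)
  moreover have "Diamond i (Suc j) \<notin> down_strip i (Suc j)" by (auto simp: down_strip_def)
  ultimately show ?thesis by (simp add: not_left_def finite_strips mult.commute)
qed

lemma not_right_first: "not_right u (first_column j) j = u (UpStep j)"
  by (simp add: not_right_def up_strip_def)

lemma not_left_last: "not_left u i (K i) = u (DownStep i)"
  by (simp add: not_left_def down_strip_def)

lemma prod_up_strips:
  assumes "finite J" shows "prod u (\<Union>k\<in>J. up_strip (f k) k) = (\<Prod>k\<in>J. not_right u (f k) k)"
  unfolding not_right_def
  by (rule prod.UNION_disjoint) (use assms in \<open>auto simp: finite_strips strips_disjoint\<close>)

lemma prod_down_strips:
  assumes "finite J" shows "prod u (\<Union>k\<in>J. down_strip k (f k)) = (\<Prod>k\<in>J. not_left u k (f k))"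
  unfolding not_left_def
  by (rule prod.UNION_disjoint) (use assms in \<open>auto simp: finite_strips strips_disjoint\<close>)

abbreviation incompatibles :: "index \<Rightarrow> index set" where
  "incompatibles X \<equiv> {Y \<in> index_set n D. \<not> compatible D X Y}"

lemma incompatibles_UpStep:
  assumes "1 \<le> j" "j \<le> n"
  shows "incompatibles (UpStep j) = (\<Union>k\<in>{first_column j..j}. down_strip k j)"
    (is "_ = ?R")
proof -
  have "Y \<in> incompatibles (UpStep j) \<longleftrightarrow> Y \<in> ?R" for Y
  proof (cases Y)
    case (UpStep k) then show ?thesis by auto
  next
    case (DownStep k)
    then show ?thesis
      using assms first_column[OF assms] first_column_le_iff[OF assms, of k]
      by (auto simp: steps_in_index down_before_up)
  next
    case (Diamond k l)
    then show ?thesis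
      using assms first_column[OF assms] first_column_le_iff[OF assms, of k]
      by (auto simp: Diamond_in_index point_def)
  qed
  then show ?thesis by blast
qed

lemma incompatibles_DownStep:
  assumes "1 \<le> i" "i \<le> n"
  shows "incompatibles (DownStep i) = (\<Union>k\<in>{i..K i}. up_strip i k)"
    (is "_ = ?R")
proof -
  have "Y \<in> incompatibles (DownStep i) \<longleftrightarrow> Y \<in> ?R" for Y
  proof (cases Y)
    case (UpStep k)
    then show ?thesis
      using assms height_le[OF assms]
      by (auto simp: steps_in_index down_before_up)
  next
    case (DownStep k) then show ?thesis by auto
  next
    case (Diamond k l)
    then show ?thesis
      using assms height_le[OF assms] height_mono[of k i] point_iff_first_column[of l k] point_le[of k l]
      by (auto simp: Diamond_in_index point_def)
  qed
  then show ?thesis by blast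
qed

text \<open>
  Two intervals that are neither nested nor disjoint overlap on one side or on the other; the two
  cases give the two families of strips below.
\<close>

lemma incompatible_Diamonds_iff:
  assumes "i < j" "k < l"
  shows "\<not> compatible D (Diamond i j) (Diamond k l) \<longleftrightarrow> k < i \<and> i \<le> l \<and> l < j \<or> i < k \<and> k \<le> j \<and> j < l"
  using assms by (auto simp: disjoint_iff dest: spec[of _ k] spec[of _ i] spec[of _ j] spec[of _ l])

lemma incompatibles_Diamond:
  assumes "point i j" "i < j"
  shows "incompatibles (Diamond i j) =
    (\<Union>k\<in>{i..<j}. up_strip i k) \<union> (\<Union>k\<in>{i<..j}. down_strip k j)"
    (is "_ = ?R")
proof -
  have "Y \<in> incompatibles (Diamond i j) \<longleftrightarrow> Y \<in> ?R" for Y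
  proof (cases Y)
    case (UpStep k)
    then show ?thesis
      using assms point_le[of i j]
      by (auto simp: steps_in_index point_def)
  next
    case (DownStep k)
    then show ?thesis
      using assms point_le[of i j]
      by (auto simp: steps_in_index point_def)
  next
    case (Diamond k l)
    have lhs: "Y \<in> incompatibles (Diamond i j) \<longleftrightarrow>
        point k l \<and> k < l \<and> (k < i \<and> i \<le> l \<and> l < j \<or> i < k \<and> k \<le> j \<and> j < l)"
      using incompatible_Diamonds_iff[of i j k l] assms Diamond by (auto simp: Diamond_in_index)
    have rhs: "Y \<in> ?R \<longleftrightarrow> first_column l \<le> k \<and> k < i \<and> i \<le> l \<and> l < j \<or>
        i < k \<and> k \<le> j \<and> j < l \<and> l \<le> K k"
      using Diamond by auto
    show ?thesis
    proof (cases "k < i \<and> i \<le> l \<and> l < j")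
      case True
      then have "1 \<le> l" "l \<le> n" using assms point_le[of i j] by (auto simp: point_def)
      then have "point k l \<longleftrightarrow> first_column l \<le> k" using True by (simp add: point_iff_first_column)
      then show ?thesis unfolding lhs rhs using True by simp
    next
      case False
      have "point k l \<longleftrightarrow> l \<le> K k" if "i < k" "k \<le> j" "j < l"
        using that assms point_le[of i j] by (simp add: point_def)
      then show ?thesis unfolding lhs rhs using False by auto
    qed
  qed
  then show ?thesis by blast
qed

lemma prod_incompatibles_Diamond:
  assumes "point i j" "i < j"
  shows "prod u (incompatibles (Diamond i j)) =
    (\<Prod>k\<in>{i..<j}. not_right u i k) * (\<Prod>k\<in>{i<..j}. not_left u k j)"
proof -
  have "(\<Union>k\<in>{i..<j}. up_strip i k) \<inter> (\<Union>k\<in>{i<..j}. down_strip k j) = {}"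
    unfolding Int_UN_distrib2 by (simp add: strips_disjoint)
  then show ?thesis
    unfolding incompatibles_Diamond[OF assms]
    by (simp add: prod.union_disjoint finite_strips
        prod_up_strips[where f = "\<lambda>_. i"] prod_down_strips[where f = "\<lambda>_. j"])
qed

lemma prod_incompatibles_UpStep:
  assumes "1 \<le> j" "j \<le> n"
  shows "prod u (incompatibles (UpStep j)) = (\<Prod>k\<in>{first_column j..j}. not_left u k j)"
  unfolding incompatibles_UpStep[OF assms] by (simp add: prod_down_strips)

lemma prod_incompatibles_DownStep:
  assumes "1 \<le> i" "i \<le> n"
  shows "prod u (incompatibles (DownStep i)) = (\<Prod>k\<in>{i..K i}. not_right u i k)"
  unfolding incompatibles_DownStep[OF assms] by (simp add: prod_up_strips)

end

section \<open>The interval distributions of a solution\<close>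

context dyck begin

text \<open>
  The real form of a point of the nonnegative part, without the convention for values off the
  index set.
\<close>

definition solution :: "(index \<Rightarrow> real) \<Rightarrow> bool" where
  "solution u \<longleftrightarrow> (\<forall>X\<in>index_set n D. 0 \<le> u X \<and> u X + prod u (incompatibles X) = 1)"

lemma solution_eq: "solution u \<Longrightarrow> X \<in> index_set n D \<Longrightarrow> u X + prod u (incompatibles X) = 1"
  by (simp add: solution_def)

text \<open>
  The complement of avoiding the right end \<open>j\<close> is being equal to \<open>j\<close>, which has the probability of
  discarding the left ends \<open>i - 1, \<dots>, j - 1\<close> one after the other. On the rim of the region,
  where \<open>i\<close> is the first column of row \<open>j\<close> or \<open>j\<close> is the top of column \<open>i\<close>, the two identities are
  the equations of a step. They then propagate inwards: the identities at \<open>(i, j)\<close> and the equation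
  of the diamond \<open>(i, j)\<close> imply the first one at \<open>(i + 1, j)\<close> and the second one at \<open>(i, j - 1)\<close>.
  So the induction is on decreasing \<open>j - i\<close>.
\<close>

lemma complement_identities:
  assumes "solution u" "point i j"
  shows "not_right u i j + (\<Prod>k=i..j. not_left u k j) = 1 \<and>
    not_left u i j + (\<Prod>k=i..j. not_right u i k) = 1"
  using assms(2)
proof (induction "n + i - j" arbitrary: i j rule: less_induct)
  case less
  note p = \<open>point i j\<close>
  have i: "1 \<le> i" "i \<le> n" "i \<le> j" "j \<le> K i" and j: "1 \<le> j" "j \<le> n"
    using p point_le[OF p] by (auto simp: point_def)
  have right: "not_right u i j + (\<Prod>k=i..j. not_left u k j) = 1"
  proof (cases "i = first_column j")
    case True
    then show ?thesis
      using solution_eq[OF assms(1), of "UpStep j"] prod_incompatibles_UpStep[OF j, of u] j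
      by (simp add: steps_in_index not_right_first)
  next
    case False
    then obtain i' where i': "i = Suc i'" "first_column j \<le> i'"
      using p j by (cases i) (auto simp: point_iff_first_column)
    then have p': "point i' j" "i' < j" using i j by (auto simp: point_iff_first_column)
    let ?l = "not_right u i' j" and ?r = "not_left u i' j"
    let ?L = "\<Prod>k\<in>{i'..<j}. not_right u i' k" and ?R = "\<Prod>k=i..j. not_left u k j"
    have "{i'<..j} = {i..j}" using i' by auto
    then have "u (Diamond i' j) = 1 - ?L * ?R"
      using solution_eq[OF assms(1), of "Diamond i' j"] prod_incompatibles_Diamond[OF p', of u] p'
      by (simp add: Diamond_in_index)
    moreover have "?l + ?r * ?R = 1" "?r + ?L * ?l = 1"
      using less(1)[OF _ p'(1)] i' p' j prod.atLeast_Suc_atMost[of i' j "\<lambda>k. not_left u k j"]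
        prod.last_plus[of i' j "not_right u i'"] by (simp_all add: mult.commute)
    moreover have "not_right u i j = ?l * u (Diamond i' j)"
      using not_right_step[OF p', of u] i' by simp
    ultimately show ?thesis by algebra
  qed
  have left: "not_left u i j + (\<Prod>k=i..j. not_right u i k) = 1"
  proof (cases "j = K i")
    case True
    then show ?thesis
      using solution_eq[OF assms(1), of "DownStep i"] prod_incompatibles_DownStep[OF i(1,2), of u] i
      by (simp add: steps_in_index not_left_last)
  next
    case False
    then have p': "point i (Suc j)" using i by (auto simp: point_def)
    let ?l = "not_right u i (Suc j)" and ?r = "not_left u i (Suc j)"
    let ?L = "\<Prod>k=i..j. not_right u i k" and ?R = "\<Prod>k\<in>{i<..Suc j}. not_left u k (Suc j)"
    have "{i..<Suc j} = {i..j}" by auto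
    then have "u (Diamond i (Suc j)) = 1 - ?L * ?R"
      using solution_eq[OF assms(1), of "Diamond i (Suc j)"] prod_incompatibles_Diamond[OF p', of u] p' i
      by (simp add: Diamond_in_index)
    moreover have "?l + (\<Prod>k=i..Suc j. not_left u k (Suc j)) = 1" "?r + (\<Prod>k=i..Suc j. not_right u i k) = 1"
      using less(1)[OF _ p'] i point_le[OF p'] by linarith+
    moreover have "(\<Prod>k=i..Suc j. not_left u k (Suc j)) = ?r * ?R"
      using i by (intro prod.head) simp
    moreover have "(\<Prod>k=i..Suc j. not_right u i k) = ?L * ?l"
      using i by simp
    moreover have "not_left u i j = ?r * u (Diamond i (Suc j))"
      using not_left_step[OF p', of u] i by simp
    ultimately show ?thesis by algebra
  qed
  show ?case using right left by blast
qed

text \<open>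
  The weight of \<open>t\<close> in \<open>{i - 1..j}\<close>: first discard the right ends \<open>j, \<dots>, t + 1\<close>, then the
  left ends \<open>i - 1, \<dots>, t - 1\<close> of the remaining interval \<open>{i - 1..t}\<close>.
\<close>

definition interval_prob :: "(index \<Rightarrow> real) \<Rightarrow> nat \<Rightarrow> nat \<Rightarrow> nat \<Rightarrow> real" where
  "interval_prob u i j t = (\<Prod>k\<in>{t<..j}. not_right u i k) * (\<Prod>k\<in>{i..t}. not_left u k t)"

lemma not_nonneg:
  assumes "solution u" "point i j"
  shows "0 \<le> not_right u i j" "0 \<le> not_left u i j"
  using assms strips_subset_index[OF assms(2)]
  by (auto simp: not_right_def not_left_def solution_def intro!: prod_nonneg)

lemma interval_prob_nonneg:
  assumes "solution u" "point i j" "t \<in> {i - 1..j}"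
  shows "0 \<le> interval_prob u i j t"
proof -
  have "point i k" if "k \<in> {t<..j}" for k
    using that assms(3) by (intro point_subinterval[OF assms(2)]) auto
  moreover have "point k t" if "k \<in> {i..t}" for k
    using that assms(3) by (intro point_subinterval[OF assms(2)]) auto
  ultimately show ?thesis
    unfolding interval_prob_def
    by (intro mult_nonneg_nonneg prod_nonneg not_nonneg[OF assms(1)]) auto
qed

lemma interval_prob_left_end:
  assumes "solution u" "point i j"
  shows "interval_prob u i j (i - 1) = 1 - not_left u i j"
proof -
  have "{i - 1<..j} = {i..j}" "{i..i - 1} = {}" using assms(2) by (auto simp: point_def)
  then show ?thesis using complement_identities[OF assms] by (simp add: interval_prob_def)
qed

lemma interval_prob_right_end:
  assumes "solution u" "point i j"
  shows "interval_prob u i j j = 1 - not_right u i j"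
  using complement_identities[OF assms] by (simp add: interval_prob_def)

text \<open>
  Conditioned on avoiding the right end, the distribution on an interval is the one on the interval
  without this end; the identity for the right end supplies the missing mass.
\<close>

lemma interval_prob_sum:
  assumes "solution u" "point i j"
  shows "(\<Sum>t\<in>{i - 1..j}. interval_prob u i j t) = 1"
proof -
  obtain a where a: "i = Suc a" using assms(2) by (cases i) (auto simp: point_def)
  have "j' \<le> j \<Longrightarrow> (\<Sum>t\<in>{a..j'}. interval_prob u (Suc a) j' t) = 1" if "a \<le> j'" for j'
    using that
  proof (induction j' rule: dec_induct)
    case base
    then show ?case by (simp add: interval_prob_def)
  next
    case (step m)
    have p: "point (Suc a) (Suc m)" using assms(2) a step by (auto intro: point_subinterval)
    have "interval_prob u (Suc a) (Suc m) t = not_right u (Suc a) (Suc m) * interval_prob u (Suc a) m t"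
      if "t \<in> {a..m}" for t
    proof -
      have "{t<..Suc m} = insert (Suc m) {t<..m}" using that by auto
      then show ?thesis by (simp add: interval_prob_def)
    qed
    then have "(\<Sum>t\<in>{a..Suc m}. interval_prob u (Suc a) (Suc m) t) =
        not_right u (Suc a) (Suc m) + interval_prob u (Suc a) (Suc m) (Suc m)"
      using step by (simp add: sum_distrib_left[symmetric])
    then show ?case using interval_prob_right_end[OF assms(1) p] by simp
  qed
  from this[of j] show ?thesis using a assms(2) by (simp add: point_def)
qed

end

section \<open>Where a coordinate vanishes\<close>

context dyck begin

text \<open>
  The face of the polytope attached to \<open>X\<close> belongs to the height function that is \<open>-1\<close> on the following interval and \<open>0\<close>
  elsewhere. The intervals can be read off from the formulas for \<open>u\<^sub>X\<close> in the \<open>z\<^sub>t\<close>: the variable of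
  a diamond vanishes when its middle part \<open>Z[i..j-1]\<close> becomes negligible against both outer terms
  \<open>z\<^sub>i\<^sub>-\<^sub>1\<close> and \<open>z\<^sub>j\<close>, that of \<open>(\<Sigma> i)\<close> when \<open>z\<^sub>i\<^sub>-\<^sub>1\<close> dominates everything to the right, and that of \<open>(j)\<close> when
  \<open>z\<^sub>j\<close> dominates everything to the left.
\<close>

fun low_set :: "index \<Rightarrow> nat set" where
  "low_set (UpStep j) = {..<j}"
| "low_set (DownStep i) = {i..}"
| "low_set (Diamond i j) = {i..<j}"

text \<open>
  If \<open>u\<^sub>X = 0\<close>, then every strip through \<open>X\<close> has product zero, and the weights in question contain such
  a strip. Conversely the condition makes some distribution a point mass at an end of its interval,
  so that a \<open>not_left\<close> or a \<open>not_right\<close> vanishes. For a step this product is \<open>u\<^sub>X\<close> itself. For a diamond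
  it gives \<open>not_left u i j * u\<^sub>X = 0\<close> and \<open>not_right u i j * u\<^sub>X = 0\<close>, and the two factors cannot both
  vanish, since a random element of an interval with more than one element avoids one of its ends.
\<close>

lemma zero_iff_interval_prob_zero:
  assumes u: "solution u" and X: "X \<in> index_set n D"
  shows "u X = 0 \<longleftrightarrow> (\<forall>i j. point i j \<longrightarrow> (\<forall>t\<in>{i - 1..j}.
    t \<in> low_set X \<longrightarrow> \<not> {i - 1..j} \<subseteq> low_set X \<longrightarrow> interval_prob u i j t = 0))"
    (is "_ \<longleftrightarrow> ?R")
proof
  assume zero: "u X = 0"
  have right: "interval_prob u i j t = 0" if "t < k" "k \<le> j" "X \<in> up_strip i k" for i j t k
    using zero that by (force simp: interval_prob_def not_right_def finite_strips intro!: prod_zero)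
  have left: "interval_prob u i j t = 0" if "i \<le> k" "k \<le> t" "X \<in> down_strip k t" for i j t k
    using zero that by (force simp: interval_prob_def not_left_def finite_strips intro!: prod_zero)
  show ?R
  proof (intro allI impI ballI)
    fix i j t
    assume p: "point i j" and t: "t \<in> {i - 1..j}" "t \<in> low_set X" "\<not> {i - 1..j} \<subseteq> low_set X"
    show "interval_prob u i j t = 0"
    proof (cases X)
      case (UpStep k)
      then show ?thesis using t by (intro right[of t k]) auto
    next
      case (DownStep k)
      then show ?thesis using t by (intro left[of i k]) auto
    next
      case (Diamond k l)
      have X': "point k l" "k < l" using X Diamond by (auto simp: Diamond_in_index)
      have t': "k \<le> t" "t < l" using t(2) Diamond by auto
      show ?thesis
      proof (cases "i \<le> k")
        case True
        then show ?thesis using t' X' Diamond by (intro left[of i k]) (auto simp: point_def)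
      next
        case False
        then have "l \<le> j" using t Diamond by (auto simp: subset_iff)
        moreover have "first_column l \<le> k"
          using X' point_le[OF X'(1)] point_iff_first_column[of l k] by (auto simp: point_def)
        ultimately show ?thesis using t' False Diamond by (intro right[of t l]) auto
      qed
    qed
  qed
next
  assume R: ?R
  have concentrated: "interval_prob u i j s = 1"
    if p: "point i j" and s: "s \<in> {i - 1..j}" "s \<notin> low_set X" "{i - 1..j} - {s} \<subseteq> low_set X" for i j s
  proof -
    have "interval_prob u i j t = 0" if "t \<in> {i - 1..j} - {s}" for t
      using R p s that by blast
    then show ?thesis
      using interval_prob_sum[OF u p] sum.remove[OF _ s(1), of "interval_prob u i j"] by simp
  qed
  show "u X = 0"
  proof (cases X)
    case (UpStep k)
    then have k: "1 \<le> k" "k \<le> n" using X by (auto simp: steps_in_index)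
    have p: "point (first_column k) k" using first_column[OF k] by (simp add: point_iff_first_column k)
    have "interval_prob u (first_column k) k k = 1"
      by (rule concentrated[OF p]) (use UpStep first_column[OF k] in auto)
    then show ?thesis using interval_prob_right_end[OF u p] UpStep by (simp add: not_right_first)
  next
    case (DownStep k)
    then have k: "1 \<le> k" "k \<le> n" using X by (auto simp: steps_in_index)
    have p: "point k (K k)" using k height_ge by (simp add: point_def)
    have "interval_prob u k (K k) (k - 1) = 1"
      by (rule concentrated[OF p]) (use DownStep k height_ge[OF k] in auto)
    then show ?thesis using interval_prob_left_end[OF u p] DownStep by (simp add: not_left_last)
  next
    case (Diamond k l)
    then obtain m where p: "point k l" "k < l" and m: "l = Suc m" "k \<le> m"
      using X by (cases l) (auto simp: Diamond_in_index)
    have k: "1 \<le> k" using p by (auto simp: point_def)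
    have p1: "point k m" and p2: "point (Suc k) l" using p m by (auto intro: point_subinterval[OF p(1)])
    have "interval_prob u k m (k - 1) = 1"
      by (rule concentrated[OF p1]) (use Diamond m k in auto)
    then have 1: "not_left u k l * u X = 0"
      using interval_prob_left_end[OF u p1] not_left_step[of k m u] p m Diamond by simp
    have "interval_prob u (Suc k) l l = 1"
      by (rule concentrated[OF p2]) (use Diamond p in auto)
    then have 2: "not_right u k l * u X = 0"
      using interval_prob_right_end[OF u p2] not_right_step[OF p, of u] Diamond by simp
    have "(\<Prod>i=k..l. not_left u i l) = not_left u k l * (\<Prod>i=Suc k..l. not_left u i l)"
      using p by (simp add: prod.atLeast_Suc_atMost)
    then show ?thesis using 1 2 complement_identities[OF u p(1)] by auto
  qed
qed

end

section \<open>Solutions with prescribed supports\<close>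

definition maximizers :: "('a \<Rightarrow> real) \<Rightarrow> 'a set \<Rightarrow> 'a set" where
  "maximizers h A = {t \<in> A. \<forall>s\<in>A. h s \<le> h t}"

text \<open>
  The limit, for \<open>s \<rightarrow> \<infinity>\<close>, of the distribution on \<open>A\<close> with weights proportional to
  \<open>exp (s h\<^sub>t)\<close>.
\<close>

definition uniform_max :: "('a \<Rightarrow> real) \<Rightarrow> 'a set \<Rightarrow> 'a \<Rightarrow> real" where
  "uniform_max h A t = (if t \<in> maximizers h A then 1 / card (maximizers h A) else 0)"

lemma finite_maximizers: "finite A \<Longrightarrow> finite (maximizers h A)"
  by (simp add: maximizers_def)

lemma maximizers_nonempty:
  assumes "finite A" "A \<noteq> {}" shows "maximizers h A \<noteq> {}"
proof -
  have "Max (h ` A) \<in> h ` A" using assms by simp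
  then obtain t where "t \<in> A" "h t = Max (h ` A)" by fastforce
  then have "t \<in> maximizers h A" using assms by (auto simp: maximizers_def)
  then show ?thesis by blast
qed

lemma uniform_max_bounds:
  assumes "finite A" shows "0 \<le> uniform_max h A t" "uniform_max h A t \<le> 1"
proof -
  show "0 \<le> uniform_max h A t" by (simp add: uniform_max_def)
  have "t \<in> maximizers h A \<Longrightarrow> 1 \<le> card (maximizers h A)"
    using finite_maximizers[OF assms, of h] by (auto simp: Suc_le_eq card_gt_0_iff)
  then show "uniform_max h A t \<le> 1" by (auto simp: uniform_max_def divide_le_eq)
qed

lemma uniform_max_pos_iff:
  assumes "finite A" shows "uniform_max h A t \<noteq> 0 \<longleftrightarrow> t \<in> maximizers h A"
  using finite_maximizers[OF assms, of h] by (auto simp: uniform_max_def)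

lemma uniform_max_singleton: "uniform_max h {t} t = 1"
proof -
  have "maximizers h {t} = {t}" by (auto simp: maximizers_def)
  then show ?thesis by (simp add: uniform_max_def)
qed

lemma uniform_max_sum:
  assumes "finite A" "A \<noteq> {}" shows "(\<Sum>t\<in>A. uniform_max h A t) = 1"
proof -
  have "maximizers h A \<subseteq> A" by (auto simp: maximizers_def)
  then show ?thesis
    using assms maximizers_nonempty[OF assms, of h] finite_maximizers[OF assms(1), of h]
    by (simp add: uniform_max_def sum.If_cases Int_absorb1)
qed

lemma uniform_max_certain:
  assumes "finite A" "uniform_max h A s = 1" "t \<noteq> s"
  shows "uniform_max h A t = 0"
proof -
  have "card (maximizers h A) = 1" "s \<in> maximizers h A"
    using assms(2) by (auto simp: uniform_max_def split: if_splits)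
  then have "maximizers h A = {s}" by (auto simp: card_1_singleton_iff)
  then show ?thesis using assms(3) by (simp add: uniform_max_def)
qed

text \<open>
  Conditioning on not being \<open>s\<close>. If \<open>s\<close> is the only maximizer, the conditional distribution on the right is
  unrelated to the left side, but then it is multiplied by zero.
\<close>

lemma uniform_max_remove:
  assumes "finite A" "s \<in> A" "t \<in> A" "t \<noteq> s"
  shows "uniform_max h A t = (1 - uniform_max h A s) * uniform_max h (A - {s}) t"
proof (cases "maximizers h A \<subseteq> {s}")
  case True
  then have "maximizers h A = {s}" using maximizers_nonempty[of A h] assms by auto
  then show ?thesis using assms by (simp add: uniform_max_def)
next
  case False
  then obtain m where m: "m \<in> A" "m \<noteq> s" "\<And>x. x \<in> A \<Longrightarrow> h x \<le> h m"
    by (auto simp: maximizers_def)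
  have "h x \<le> h t" if "t \<in> maximizers h (A - {s})" "x \<in> A" for t x
  proof -
    have "h m \<le> h t" using that(1) m(1,2) by (simp add: maximizers_def)
    then show ?thesis using m(3)[OF that(2)] by linarith
  qed
  then have eq: "maximizers h (A - {s}) = maximizers h A - {s}"
    by (auto simp: maximizers_def)
  have fin: "finite (maximizers h A)" "card (maximizers h A) \<noteq> 0"
    using finite_maximizers[OF assms(1), of h] False by auto
  have nz: "card (maximizers h A - {s}) \<noteq> 0"
    using fin False by auto
  show ?thesis
  proof (cases "s \<in> maximizers h A")
    case True
    then have "real (card (maximizers h A)) = 1 + real (card (maximizers h A - {s}))"
      using card.remove[OF fin(1) True] by simp
    then show ?thesis
      using assms nz True by (simp add: uniform_max_def eq divide_simps)
  next
    case False
    then show ?thesis using assms by (simp add: uniform_max_def eq)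
  qed
qed

context dyck begin

abbreviation wmax :: "(nat \<Rightarrow> real) \<Rightarrow> nat \<Rightarrow> nat \<Rightarrow> nat \<Rightarrow> real" where
  "wmax h i j \<equiv> uniform_max h {i - 1..j}"

lemma wmax_drop_right:
  assumes "1 \<le> i" "i \<le> j" "t \<in> {i - 1..j - 1}"
  shows "wmax h i j t = (1 - wmax h i j j) * wmax h i (j - 1) t"
proof -
  have "{i - 1..j} - {j} = {i - 1..j - 1}" using assms by auto
  moreover have "wmax h i j t = (1 - wmax h i j j) * uniform_max h ({i - 1..j} - {j}) t"
    by (rule uniform_max_remove) (use assms in auto)
  ultimately show ?thesis by (simp only:)
qed

lemma wmax_drop_left:
  assumes "1 \<le> i" "i \<le> j" "t \<in> {i..j}"
  shows "wmax h i j t = (1 - wmax h i j (i - 1)) * wmax h (Suc i) j t"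
proof -
  have "{i - 1..j} - {i - 1} = {Suc i - 1..j}" using assms by auto
  moreover have "wmax h i j t = (1 - wmax h i j (i - 1)) * uniform_max h ({i - 1..j} - {i - 1}) t"
    by (rule uniform_max_remove) (use assms in auto)
  ultimately show ?thesis by (simp only:)
qed

text \<open>
  For a diamond, the formula is the probability of avoiding \<open>j\<close> in \<open>{i..j}\<close> divided by that of avoiding
  \<open>j\<close> in \<open>{i - 1..j}\<close>, as \<open>not_right_step\<close> demands. When the denominator vanishes, all the mass of
  \<open>{i - 1..j}\<close> sits at \<open>j\<close>. Then the quotient demanded by \<open>not_left_step\<close> has denominator \<open>1\<close> and is
  used instead.
\<close>

definition limit_solution :: "(nat \<Rightarrow> real) \<Rightarrow> index \<Rightarrow> real" where
  "limit_solution h X = (case X of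
     UpStep j \<Rightarrow> 1 - wmax h (first_column j) j j
   | DownStep i \<Rightarrow> 1 - wmax h i (K i) (i - 1)
   | Diamond i j \<Rightarrow>
       if wmax h i j j \<noteq> 1 then (1 - wmax h (Suc i) j j) / (1 - wmax h i j j)
       else 1 - wmax h i (j - 1) (i - 1))"

lemma limit_solution_nonneg: "0 \<le> limit_solution h X"
  by (auto simp: limit_solution_def uniform_max_bounds divide_nonneg_nonneg split: index.split)

text \<open>
  The two quotients agree where both make sense, because the probability of avoiding both ends of
  \<open>{i - 1..j}\<close> can be computed by discarding the ends in either order.
\<close>

lemma limit_solution_Diamond:
  assumes "1 \<le> i" "i < j"
  shows "1 - wmax h (Suc i) j j = (1 - wmax h i j j) * limit_solution h (Diamond i j)" (is ?A)
    and "1 - wmax h i (j - 1) (i - 1) = (1 - wmax h i j (i - 1)) * limit_solution h (Diamond i j)"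
      (is ?B)
    and "limit_solution h (Diamond i j) = 1 - wmax h i (j - 1) (i - 1) * wmax h (Suc i) j j" (is ?C)
proof -
  let ?p = "wmax h i j j" and ?q = "wmax h i j (i - 1)"
  let ?L = "wmax h i (j - 1) (i - 1)" and ?R = "wmax h (Suc i) j j"
  have q: "?q = (1 - ?p) * ?L" using assms by (intro wmax_drop_right) auto
  have p: "?p = (1 - ?q) * ?R" using assms by (intro wmax_drop_left) auto
  have eq: "(1 - ?p) * (1 - ?L) = (1 - ?q) * (1 - ?R)" using p q by algebra
  have "?A \<and> ?B \<and> ?C"
  proof (cases "?p = 1")
    case True
    then have "?q = 0" using assms by (intro uniform_max_certain[of _ h j]) auto
    moreover from this have "?R = 1" using p True by simp
    ultimately show ?thesis using True by (simp add: limit_solution_def)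
  next
    case False
    then have u: "limit_solution h (Diamond i j) = (1 - ?R) / (1 - ?p)"
      by (simp add: limit_solution_def)
    have "(1 - ?q) * (1 - ?R) = (1 - ?p) * (1 - ?L)" using eq by simp
    moreover have "1 - ?R = (1 - ?p) * (1 - ?L * ?R)"
      using p q by algebra
    ultimately show ?thesis using False by (simp add: u)
  qed
  then show ?A ?B ?C by blast+
qed

lemma limit_solution_not_right:
  assumes "point i j" shows "not_right (limit_solution h) i j = 1 - wmax h i j j"
proof -
  have j: "1 \<le> j" "j \<le> n" using assms point_le[of i j] by (auto simp: point_def)
  have "first_column j \<le> i" using assms point_iff_first_column[OF j] by blast
  then show ?thesis using assms
  proof (induction i rule: dec_induct)
    case base
    then show ?case by (simp add: not_right_first limit_solution_def)
  next
    case (step i)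
    then have p: "point i j" "i < j" "1 \<le> i"
      using j first_column[OF j] by (auto simp: point_iff_first_column)
    show ?case
      using step.IH[OF p(1)] not_right_step[OF p(1,2), of "limit_solution h"]
        limit_solution_Diamond(1)[OF p(3,2), of h] by simp
  qed
qed

lemma limit_solution_not_left:
  assumes "point i j" shows "not_left (limit_solution h) i j = 1 - wmax h i j (i - 1)"
proof -
  have "j \<le> K i" using assms by (simp add: point_def)
  then show ?thesis using assms
  proof (induction j rule: inc_induct)
    case base
    then show ?case by (simp add: not_left_last limit_solution_def)
  next
    case (step j)
    then have p: "point i (Suc j)" "i \<le> j" "1 \<le> i" by (auto simp: point_def)
    show ?case
      using step.IH[OF p(1)] not_left_step[OF p(1,2), of "limit_solution h"] limit_solution_Diamond(2)[of i "Suc j" h] p by simp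
  qed
qed

lemma prod_limit_not_right:
  assumes "point i j" "t \<in> {i - 1..j}"
  shows "(\<Prod>k\<in>{t<..j}. not_right (limit_solution h) i k) * wmax h i t t = wmax h i j t"
proof -
  have "t \<le> j" using assms by simp
  then show ?thesis using assms
  proof (induction j rule: dec_induct)
    case base
    then show ?case by simp
  next
    case (step m)
    show ?case
    proof (cases "i \<le> m")
      case True
      then have "point i m" using step by (auto intro: point_subinterval)
      moreover have "{t<..Suc m} = insert (Suc m) {t<..m}" using step by auto
      moreover have "wmax h i (Suc m) t = (1 - wmax h i (Suc m) (Suc m)) * wmax h i (Suc m - 1) t"
        using step True by (intro wmax_drop_right) (auto simp: point_def)
      ultimately show ?thesis
        using step limit_solution_not_right[OF step.prems(1)] by (simp add: mult.assoc)
    next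
      case False
      then have im: "i = Suc m" "t = m" using step by (auto simp: point_def)
      have "wmax h i (Suc m) t = (1 - wmax h i (Suc m) (Suc m)) * wmax h i (Suc m - 1) t"
        using step im by (intro wmax_drop_right) (auto simp: point_def)
      moreover have "{m<..Suc m} = {Suc m}" by auto
      ultimately show ?thesis
        using im limit_solution_not_right[OF step.prems(1)] by simp
    qed
  qed
qed

lemma prod_limit_not_left:
  assumes "point i j"
  shows "(\<Prod>k=i..j. not_left (limit_solution h) k j) = wmax h i j j"
proof -
  have "i \<le> j" using assms by (simp add: point_def)
  then show ?thesis using assms
  proof (induction i rule: inc_induct)
    case base
    have "wmax h j j j = (1 - wmax h j j (j - 1)) * wmax h (Suc j) j j"
      using base by (intro wmax_drop_left) (auto simp: point_def)
    then show ?case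
      using limit_solution_not_left[OF base] by (simp add: uniform_max_singleton)
  next
    case (step i)
    have "wmax h i j j = (1 - wmax h i j (i - 1)) * wmax h (Suc i) j j"
      using step by (intro wmax_drop_left) (auto simp: point_def)
    moreover have "point (Suc i) j" using step by (auto intro: point_subinterval)
    ultimately show ?case
      using step limit_solution_not_left[OF step.prems] by (simp add: prod.atLeast_Suc_atMost)
  qed
qed

lemma prod_limit_not_right_all:
  assumes "point i j"
  shows "(\<Prod>k=i..j. not_right (limit_solution h) i k) = wmax h i j (i - 1)"
proof -
  have "{i - 1<..j} = {i..j}" "i - 1 \<in> {i - 1..j}" using assms by (auto simp: point_def)
  then show ?thesis
    using prod_limit_not_right[OF assms, of "i - 1" h] by (simp add: uniform_max_singleton)
qed

lemma limit_solution_prob: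
  assumes "point i j" "t \<in> {i - 1..j}"
  shows "interval_prob (limit_solution h) i j t = wmax h i j t"
proof -
  have "(\<Prod>k=i..t. not_left (limit_solution h) k t) = wmax h i t t"
  proof (cases "i \<le> t")
    case True
    then show ?thesis
      using assms by (intro prod_limit_not_left) (auto intro: point_subinterval)
  next
    case False
    then have "i = Suc t" using assms by (auto simp: point_def)
    then show ?thesis by (simp add: uniform_max_singleton)
  qed
  then show ?thesis
    using prod_limit_not_right[OF assms] by (simp add: interval_prob_def)
qed

lemma solution_limit_solution: "solution (limit_solution h)"
  unfolding solution_def
proof (intro ballI conjI limit_solution_nonneg)
  fix X assume X: "X \<in> index_set n D"
  let ?u = "limit_solution h"
  show "?u X + prod ?u (incompatibles X) = 1"
  proof (cases X)
    case (UpStep j)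
    then have j: "1 \<le> j" "j \<le> n" using X by (auto simp: steps_in_index)
    have "point (first_column j) j" using first_column[OF j] by (simp add: point_iff_first_column j)
    from prod_limit_not_left[OF this] show ?thesis
      using prod_incompatibles_UpStep[OF j, of ?u] UpStep by (simp add: limit_solution_def)
  next
    case (DownStep i)
    then have i: "1 \<le> i" "i \<le> n" using X by (auto simp: steps_in_index)
    have "point i (K i)" using i height_ge by (simp add: point_def)
    from prod_limit_not_right_all[OF this] show ?thesis
      using prod_incompatibles_DownStep[OF i, of ?u] DownStep by (simp add: limit_solution_def)
  next
    case (Diamond i j)
    then have p: "point i j" "i < j" "1 \<le> i" using X by (auto simp: Diamond_in_index point_def)
    have "{i<..j} = {Suc i..j}" "{i..<j} = {i..j - 1}" using p by auto
    moreover have "point (Suc i) j" "point i (j - 1)" using p by (auto intro: point_subinterval)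
    ultimately show ?thesis
      using prod_incompatibles_Diamond[OF p(1,2), of ?u] limit_solution_Diamond(3)[OF p(3,2)] Diamond
        prod_limit_not_left[of "Suc i" j] prod_limit_not_right_all[of i "j - 1"] by simp
  qed
qed

end

section \<open>The polytope as a Minkowski sum of simplices\<close>

text \<open>
  Unlike in \<open>convex_hull_finite\<close>, the weights are indexed by \<open>J\<close>, so that \<open>f\<close> may identify points.
\<close>

lemma convex_hull_finite_image:
  assumes "finite J"
  shows "convex hull (f ` J) =
    {\<Sum>t\<in>J. w t *\<^sub>R f t | w. (\<forall>t\<in>J. (0::real) \<le> w t) \<and> sum w J = 1}" (is "_ = ?R")
proof
  show "convex hull (f ` J) \<subseteq> ?R"
  proof (rule hull_minimal)
    show "f ` J \<subseteq> ?R"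
    proof
      fix x assume "x \<in> f ` J"
      then obtain s where s: "s \<in> J" "x = f s" by auto
      let ?w = "\<lambda>t. if t = s then 1 else 0 :: real"
      have "(\<Sum>t\<in>J. ?w t *\<^sub>R f t) = (\<Sum>t\<in>J. if t = s then f t else 0)"
        by (rule sum.cong) auto
      then have "x = (\<Sum>t\<in>J. ?w t *\<^sub>R f t)" "sum ?w J = 1" using s assms by auto
      then show "x \<in> ?R" by (intro CollectI exI[of _ ?w]) simp
    qed
    show "convex ?R"
    proof (rule convexI, clarify)
      fix a b :: real and v w :: "'a \<Rightarrow> real"
      assume ab: "0 \<le> a" "0 \<le> b" "a + b = 1"
        and v: "\<forall>t\<in>J. 0 \<le> v t" "sum v J = 1" and w: "\<forall>t\<in>J. 0 \<le> w t" "sum w J = 1"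
      let ?z = "\<lambda>t. a * v t + b * w t"
      have "a *\<^sub>R (\<Sum>t\<in>J. v t *\<^sub>R f t) + b *\<^sub>R (\<Sum>t\<in>J. w t *\<^sub>R f t) = (\<Sum>t\<in>J. ?z t *\<^sub>R f t)"
        by (simp add: scaleR_sum_right sum.distrib scaleR_add_left)
      moreover have "sum ?z J = 1"
        using v w ab by (simp add: sum.distrib sum_distrib_left[symmetric])
      ultimately show "\<exists>z. a *\<^sub>R (\<Sum>t\<in>J. v t *\<^sub>R f t) + b *\<^sub>R (\<Sum>t\<in>J. w t *\<^sub>R f t) =
          (\<Sum>t\<in>J. z t *\<^sub>R f t) \<and> (\<forall>t\<in>J. 0 \<le> z t) \<and> sum z J = 1"
        using v w ab by (intro exI[of _ ?z]) simp
    qed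
  qed
  show "?R \<subseteq> convex hull (f ` J)"
  proof clarify
    fix w :: "'a \<Rightarrow> real" assume "\<forall>t\<in>J. 0 \<le> w t" "sum w J = 1"
    then show "(\<Sum>t\<in>J. w t *\<^sub>R f t) \<in> convex hull (f ` J)"
      using assms by (intro convex_sum) (auto intro: hull_inc)
  qed
qed

lemma bij_coord_number:
  "bij_betw (coord_number :: 'n::{finite,linorder} \<Rightarrow> nat) UNIV {1..CARD('n)}"
proof -
  have less: "coord_number a < coord_number b" if "a < b" for a b :: 'n
    unfolding coord_number_def using that by (intro psubset_card_mono) auto
  then have inj: "inj (coord_number :: 'n \<Rightarrow> nat)"
    by (metis injI less_irrefl neqE)
  have "range (coord_number :: 'n \<Rightarrow> nat) \<subseteq> {1..CARD('n)}"
    by (auto simp: coord_number_def Suc_le_eq card_gt_0_iff intro!: card_mono)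
  then have "range (coord_number :: 'n \<Rightarrow> nat) = {1..CARD('n)}"
    by (intro card_subset_eq) (simp_all add: card_image inj)
  with inj show ?thesis by (simp add: bij_betw_def)
qed

text \<open>
  The exponent of \<open>y\<^sub>i \<cdots> y\<^sub>k\<close>; for \<open>k = i - 1\<close> it is zero, the exponent of the constant term of \<open>F\<^sub>i\<^sub>j\<close>.
\<close>

definition monomial :: "nat \<Rightarrow> nat \<Rightarrow> nat \<Rightarrow>\<^sub>0 nat" where
  "monomial i k = (\<Sum>m\<in>{i..k}. Poly_Mapping.single m 1)"

lemma prod_var: "(\<Prod>m=i..k. var m) = Poly_Mapping.single (monomial i k) 1"
proof -
  have "finite A \<Longrightarrow> (\<Prod>m\<in>A. var m) = Poly_Mapping.single (\<Sum>m\<in>A. Poly_Mapping.single m 1) 1" for A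
    by (induction A rule: finite_induct) (simp_all add: var_def mult_single)
  then show ?thesis by (simp add: monomial_def)
qed

lemma keys_F_poly:
  assumes "1 \<le> i" "i \<le> j"
  shows "Poly_Mapping.keys (F_poly i j) = monomial i ` {i - 1..j}"
proof -
  have "monomial i (i - 1) = 0" using assms by (simp add: monomial_def)
  then have "(1 :: (nat \<Rightarrow>\<^sub>0 nat) \<Rightarrow>\<^sub>0 int) = Poly_Mapping.single (monomial i (i - 1)) 1" by simp
  moreover have "{i - 1..j} = insert (i - 1) {i..j}" "i - 1 \<notin> {i..j}" using assms by auto
  ultimately have F: "F_poly i j = (\<Sum>k\<in>{i - 1..j}. Poly_Mapping.single (monomial i k) 1)"
    by (simp add: F_poly_def prod_var)
  have "Poly_Mapping.lookup (F_poly i j) e = of_nat (card {k \<in> {i - 1..j}. monomial i k = e})" for e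
    unfolding F by (simp add: lookup_sum lookup_single when_def sum.If_cases Int_def eq_commute)
  then show ?thesis by (auto simp: in_keys_iff)
qed

definition corner :: "nat \<Rightarrow> nat \<Rightarrow> real ^ 'n::{finite,linorder}" where
  "corner i k = (\<chi> a. if coord_number a \<in> {i..k} then 1 else 0)"

lemma exponent_vector_monomial: "exponent_vector (monomial i k) = corner i k"
proof -
  have "Poly_Mapping.lookup (monomial i k) c = (if c \<in> {i..k} then 1 else 0)" for c
    by (simp add: monomial_def lookup_sum lookup_single when_def)
  then show ?thesis by (simp add: exponent_vector_def corner_def vec_eq_iff)
qed

lemma Newt_F_poly:
  assumes "1 \<le> i" "i \<le> j"
  shows "Newt (F_poly i j) = convex hull (corner i ` {i - 1..j})"
  by (simp add: Newt_def keys_F_poly[OF assms] image_image exponent_vector_monomial)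

text \<open>
  A weighting chooses a distribution on the corners of each of the simplices \<open>Newt(F\<^sub>i\<^sub>j)\<close>, and so a point
  in their Minkowski sum.
\<close>

definition weighting :: "(nat \<times> nat) set \<Rightarrow> (nat \<Rightarrow> nat \<Rightarrow> nat \<Rightarrow> real) \<Rightarrow> bool" where
  "weighting A w \<longleftrightarrow> (\<forall>(i, j)\<in>A. (\<forall>t\<in>{i - 1..j}. 0 \<le> w i j t) \<and> (\<Sum>t\<in>{i - 1..j}. w i j t) = 1)"

definition weighted_sum ::
    "(nat \<times> nat) set \<Rightarrow> (nat \<Rightarrow> nat \<Rightarrow> nat \<Rightarrow> real) \<Rightarrow> real ^ 'n::{finite,linorder}" where
  "weighted_sum A w = (\<Sum>(i, j)\<in>A. \<Sum>t\<in>{i - 1..j}. w i j t *\<^sub>R corner i t)"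

definition supported :: "(nat \<times> nat) set \<Rightarrow> (nat \<Rightarrow> real) \<Rightarrow> (nat \<Rightarrow> nat \<Rightarrow> nat \<Rightarrow> real) \<Rightarrow> bool" where
  "supported A h w \<longleftrightarrow>
     (\<forall>(i, j)\<in>A. \<forall>t\<in>{i - 1..j}. w i j t \<noteq> 0 \<longrightarrow> t \<in> maximizers h {i - 1..j})"

lemma finite_points_below: "finite (points_below n D)"
  by (rule finite_subset[of _ "{..n} \<times> {..n}"]) (auto simp: points_below_def)

lemma P_polytope_eq:
  "(P_polytope D :: (real ^ 'n::{finite,linorder}) set) =
    {weighted_sum (points_below CARD('n) D) w | w. weighting (points_below CARD('n) D) w}"
    (is "_ = ?R")
proof -
  let ?A = "points_below CARD('n) D"
  have Newt: "Newt (F_poly i j) = {\<Sum>t\<in>{i - 1..j}. w t *\<^sub>R corner i t | w.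
      (\<forall>t\<in>{i - 1..j}. 0 \<le> w t) \<and> sum w {i - 1..j} = 1}" if "(i, j) \<in> ?A" for i j
    using that by (simp add: points_below_def Newt_F_poly convex_hull_finite_image)
  show ?thesis
  proof (intro equalityI subsetI)
    fix x :: "(real, 'n) vec" assume "x \<in> P_polytope D"
    then obtain s where s: "x = sum s ?A" "\<forall>p\<in>?A. s p \<in> (case p of (i, j) \<Rightarrow> Newt (F_poly i j))"
      by (auto simp: P_polytope_def set_sum_alt finite_points_below)
    have ex: "\<exists>w. s (i, j) = (\<Sum>t\<in>{i - 1..j}. w t *\<^sub>R corner i t) \<and>
      (\<forall>t\<in>{i - 1..j}. 0 \<le> w t) \<and> sum w {i - 1..j} = 1" if "(i, j) \<in> ?A" for i j
      using bspec[OF s(2) that] unfolding prod.case Newt[OF that] by blast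
    have "\<forall>p\<in>?A. \<exists>w. s p = (\<Sum>t\<in>{fst p - 1..snd p}. w t *\<^sub>R corner (fst p) t) \<and>
      (\<forall>t\<in>{fst p - 1..snd p}. 0 \<le> w t) \<and> sum w {fst p - 1..snd p} = 1"
    proof
      fix p assume "p \<in> ?A"
      then show "\<exists>w. s p = (\<Sum>t\<in>{fst p - 1..snd p}. w t *\<^sub>R corner (fst p) t) \<and>
        (\<forall>t\<in>{fst p - 1..snd p}. 0 \<le> w t) \<and> sum w {fst p - 1..snd p} = 1"
        using ex[of "fst p" "snd p"] by simp
    qed
    from bchoice[OF this]
    obtain w where w: "\<forall>p\<in>?A. s p = (\<Sum>t\<in>{fst p - 1..snd p}. w p t *\<^sub>R corner (fst p) t) \<and>
      (\<forall>t\<in>{fst p - 1..snd p}. 0 \<le> w p t) \<and> sum (w p) {fst p - 1..snd p} = 1"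
      by blast
    have "x = weighted_sum ?A (\<lambda>i j. w (i, j))"
      unfolding s(1) weighted_sum_def using w by (intro sum.cong) auto
    moreover have "weighting ?A (\<lambda>i j. w (i, j))"
      using w by (auto simp: weighting_def)
    ultimately show "x \<in> ?R" by blast
  next
    fix x :: "(real, 'n) vec" assume "x \<in> ?R"
    then obtain w where w: "x = weighted_sum ?A w" "weighting ?A w" by blast
    let ?s = "\<lambda>(i, j). \<Sum>t\<in>{i - 1..j}. w i j t *\<^sub>R corner i t"
    have "\<forall>p\<in>?A. ?s p \<in> (case p of (i, j) \<Rightarrow> Newt (F_poly i j))"
      using w(2) Newt by (fastforce simp: weighting_def)
    moreover have "x = sum ?s ?A" by (simp add: w(1) weighted_sum_def)
    ultimately show "x \<in> P_polytope D"
      by (auto simp: P_polytope_def set_sum_alt finite_points_below)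
  qed
qed

lemma polytope_P_polytope: "polytope (P_polytope D :: (real ^ 'n::{finite,linorder}) set)"
proof -
  have "(P_polytope D :: ((real, 'n) vec) set) =
      (\<Sum>(i, j)\<in>points_below CARD('n) D. convex hull (corner i ` {i - 1..j}))"
    unfolding P_polytope_def by (rule sum.cong) (auto simp: Newt_F_poly points_below_def)
  also have "\<dots> = convex hull (\<Sum>(i, j)\<in>points_below CARD('n) D. corner i ` {i - 1..j})"
    by (simp add: convex_hull_set_sum case_prod_unfold)
  moreover have "finite A \<Longrightarrow> finite (\<Sum>(i, j)\<in>A. corner i ` {i - 1..j} :: ((real, 'n) vec) set)" for A
    by (induction A rule: finite_induct) (auto intro: finite_set_plus)
  ultimately show ?thesis by (simp add: polytope_convex_hull finite_points_below)
qed

text \<open>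
  The height function of a linear functional. On a corner the functional takes the value
  \<open>potential c t - potential c (i - 1)\<close>, so that on each simplex it is, up to a constant, the height of
  the corner.
\<close>

definition potential :: "real ^ 'n::{finite,linorder} \<Rightarrow> nat \<Rightarrow> real" where
  "potential c t = (\<Sum>a | coord_number a \<le> t. c $ a)"

lemma inner_corner:
  assumes "1 \<le> i" "i - 1 \<le> k"
  shows "(c :: real ^ 'n::{finite,linorder}) \<bullet> corner i k = potential c k - potential c (i - 1)"
proof -
  have "{a :: 'n. coord_number a \<le> k} = {a. coord_number a \<in> {i..k}} \<union> {a. coord_number a \<le> i - 1}"
    using assms by auto
  then have "potential c k = (\<Sum>a | coord_number a \<in> {i..k}. c $ a) + potential c (i - 1)"
    unfolding potential_def using assms by (simp only:) (rule sum.union_disjoint, auto)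
  moreover have "c \<bullet> corner i k = (\<Sum>a | coord_number a \<in> {i..k}. c $ a)"
    by (simp add: inner_vec_def corner_def if_distrib sum.If_cases cong: if_cong)
  ultimately show ?thesis by simp
qed

lemma potential_surj:
  fixes h :: "nat \<Rightarrow> real"
  obtains c :: "real ^ 'n::{finite,linorder}"
  where "\<And>t. t \<le> CARD('n) \<Longrightarrow> potential c t = h t - h 0"
proof
  define c :: "(real, 'n) vec" where "c = (\<chi> a. h (coord_number a) - h (coord_number a - 1))"
  fix t assume t: "t \<le> CARD('n)"
  have "bij_betw coord_number {a :: 'n. coord_number a \<le> t} {1..t}"
    using bij_coord_number[where 'n = 'n] t
    by (auto simp: bij_betw_def inj_on_def image_iff set_eq_iff) (metis le_trans atLeastAtMost_iff rangeE rangeI)+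
  then have "(\<Sum>a | coord_number (a :: 'n) \<le> t. h (coord_number a) - h (coord_number a - 1)) =
      (\<Sum>m\<in>{1..t}. h m - h (m - 1))"
    by (rule sum.reindex_bij_betw)
  then have "potential c t = (\<Sum>m\<in>{1..t}. h m - h (m - 1))" by (simp add: potential_def c_def)
  also have "\<dots> = h t - h 0" by (induction t) auto
  finally show "potential c t = h t - h 0" .
qed

lemma maximizers_cong_shift:
  assumes "\<And>t. t \<in> A \<Longrightarrow> g t = h t - d"
  shows "maximizers g A = maximizers h A"
  using assms by (auto simp: maximizers_def)

lemma uniform_max_weighting:
  assumes "A \<subseteq> points_below n D"
  shows "weighting A (\<lambda>i j. uniform_max h {i - 1..j})" "supported A h (\<lambda>i j. uniform_max h {i - 1..j})"
  using assms by (auto simp: weighting_def supported_def points_below_def uniform_max_bounds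
      uniform_max_sum uniform_max_pos_iff)

definition max_value :: "(nat \<times> nat) set \<Rightarrow> (nat \<Rightarrow> real) \<Rightarrow> real" where
  "max_value A h = (\<Sum>(i, j)\<in>A. Max (h ` {i - 1..j}) - h (i - 1))"

text \<open>
  The gap between the maximum and the value is the sum of all \<open>w i j t * (M\<^sub>i\<^sub>j - h t)\<close> with nonnegative
  terms, where \<open>M\<^sub>i\<^sub>j\<close> is the maximal height on \<open>{i - 1..j}\<close>.
\<close>

lemma inner_weighted_sum:
  fixes c :: "real ^ 'n::{finite,linorder}"
  assumes A: "A \<subseteq> points_below CARD('n) D" and w: "weighting A w"
  shows "c \<bullet> weighted_sum A w \<le> max_value A (potential c)"
    and "c \<bullet> weighted_sum A w = max_value A (potential c) \<longleftrightarrow> supported A (potential c) w"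
proof -
  let ?h = "potential c"
  let ?M = "\<lambda>i j. Max (?h ` {i - 1..j})"
  have fin: "finite A" using A finite_points_below finite_subset by blast
  have le: "?h t \<le> ?M i j" if "t \<in> {i - 1..j}" for i j t
    using that by simp
  have max: "?h t = ?M i j \<longleftrightarrow> t \<in> maximizers ?h {i - 1..j}" if "t \<in> {i - 1..j}" for i j t
  proof -
    have "?M i j \<in> ?h ` {i - 1..j}" using that by (intro Max_in) auto
    then obtain s where "s \<in> {i - 1..j}" "?h s = ?M i j" by force
    then show ?thesis using that le[of _ i j] by (auto simp: maximizers_def intro: antisym)
  qed
  have "c \<bullet> weighted_sum A w = (\<Sum>(i, j)\<in>A. \<Sum>t\<in>{i - 1..j}. w i j t * (?h t - ?h (i - 1)))"
    using A unfolding weighted_sum_def inner_sum_right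
    by (intro sum.cong) (auto simp: inner_sum_right inner_corner points_below_def intro!: sum.cong)
  moreover have "?M i j - ?h (i - 1) - (\<Sum>t\<in>{i - 1..j}. w i j t * (?h t - ?h (i - 1))) =
      (\<Sum>t\<in>{i - 1..j}. w i j t * (?M i j - ?h t))" if "(i, j) \<in> A" for i j
  proof -
    have "(\<Sum>t\<in>{i - 1..j}. w i j t * (?M i j - ?h (i - 1))) = ?M i j - ?h (i - 1)"
      using w that by (auto simp: weighting_def sum_distrib_right[symmetric])
    then show ?thesis by (simp add: right_diff_distrib sum_subtractf)
  qed
  ultimately have diff: "max_value A ?h - c \<bullet> weighted_sum A w =
      (\<Sum>(i, j)\<in>A. \<Sum>t\<in>{i - 1..j}. w i j t * (?M i j - ?h t))"
    by (auto simp: max_value_def case_prod_unfold sum_subtractf[symmetric] intro!: sum.cong)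
  have nonneg: "0 \<le> w i j t * (?M i j - ?h t)" if "(i, j) \<in> A" "t \<in> {i - 1..j}" for i j t
    using w that le[OF that(2)] by (auto simp: weighting_def)
  have inner: "0 \<le> (\<Sum>t\<in>{i - 1..j}. w i j t * (?M i j - ?h t))" if "(i, j) \<in> A" for i j
    by (rule sum_nonneg) (rule nonneg[OF that])
  have eq0: "(\<Sum>t\<in>{i - 1..j}. w i j t * (?M i j - ?h t)) = 0 \<longleftrightarrow>
      (\<forall>t\<in>{i - 1..j}. w i j t * (?M i j - ?h t) = 0)" if "(i, j) \<in> A" for i j
    by (rule sum_nonneg_eq_0_iff) (simp, rule nonneg[OF that])
  have zero: "w i j t * (?M i j - ?h t) = 0 \<longleftrightarrow> (w i j t \<noteq> 0 \<longrightarrow> t \<in> maximizers ?h {i - 1..j})"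
    if "t \<in> {i - 1..j}" for i j t
    unfolding max[OF that, symmetric] by auto
  show "c \<bullet> weighted_sum A w \<le> max_value A ?h"
  proof -
    have "0 \<le> (\<Sum>(i, j)\<in>A. \<Sum>t\<in>{i - 1..j}. w i j t * (?M i j - ?h t))"
      by (rule sum_nonneg) (simp only: split_paired_all prod.case inner)
    then show ?thesis unfolding diff[symmetric] by simp
  qed
  have "c \<bullet> weighted_sum A w = max_value A ?h \<longleftrightarrow>
      (\<Sum>(i, j)\<in>A. \<Sum>t\<in>{i - 1..j}. w i j t * (?M i j - ?h t)) = 0"
    unfolding diff[symmetric] by auto
  also have "\<dots> \<longleftrightarrow> (\<forall>(i, j)\<in>A. (\<Sum>t\<in>{i - 1..j}. w i j t * (?M i j - ?h t)) = 0)"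
    by (subst sum_nonneg_eq_0_iff[OF fin])
      (simp_all only: split_paired_all prod.case inner case_prod_unfold fst_conv snd_conv)
  also have "\<dots> \<longleftrightarrow> (\<forall>(i, j)\<in>A. \<forall>t\<in>{i - 1..j}. w i j t * (?M i j - ?h t) = 0)"
    by (intro ball_cong refl) (simp only: split_paired_all prod.case eq0)
  also have "\<dots> \<longleftrightarrow> supported A ?h w"
    unfolding supported_def
    by (intro ball_cong refl) (simp only: split_paired_all prod.case zero cong: ball_cong)
  finally show "c \<bullet> weighted_sum A w = max_value A ?h \<longleftrightarrow> supported A ?h w" .
qed

lemma face_of_heights:
  fixes h :: "nat \<Rightarrow> real"
  obtains G :: "(real ^ 'n::{finite,linorder}) set"
  where "G face_of P_polytope D"
    "\<And>w. weighting (points_below CARD('n) D) w \<Longrightarrow>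
       weighted_sum (points_below CARD('n) D) w \<in> G \<longleftrightarrow> supported (points_below CARD('n) D) h w"
proof -
  let ?A = "points_below CARD('n) D"
  obtain c :: "(real, 'n) vec" where c: "\<And>t. t \<le> CARD('n) \<Longrightarrow> potential c t = h t - h 0"
    using potential_surj by blast
  have "maximizers (potential c) {i - 1..j} = maximizers h {i - 1..j}" if "(i, j) \<in> ?A" for i j
    using that by (intro maximizers_cong_shift[of _ _ _ "h 0"] c) (auto simp: points_below_def)
  then have supp: "supported ?A (potential c) w \<longleftrightarrow> supported ?A h w" for w
    unfolding supported_def by (intro ball_cong refl) auto
  let ?P = "P_polytope D :: ((real, 'n) vec) set"
  let ?G = "?P \<inter> {x. c \<bullet> x = max_value ?A (potential c)}"
  show ?thesis
  proof
    show "?G face_of ?P"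
      by (rule face_of_Int_supporting_hyperplane_le)
        (auto simp: P_polytope_eq inner_weighted_sum[OF subset_refl] polytope_imp_convex[OF polytope_P_polytope, unfolded P_polytope_eq])
    show "weighted_sum ?A w \<in> ?G \<longleftrightarrow> supported ?A h w" if "weighting ?A w" for w
      using that inner_weighted_sum(2)[OF subset_refl that, of c] by (auto simp: P_polytope_eq supp)
  qed
qed

text \<open>
  Faces of polytopes are exposed. The supporting value is the maximum, because the uniform
  weighting of the maximizers attains it.
\<close>

lemma heights_of_face:
  fixes G :: "(real ^ 'n::{finite,linorder}) set"
  assumes "G face_of P_polytope D" "G \<noteq> {}"
  obtains h :: "nat \<Rightarrow> real"
  where "\<And>w. weighting (points_below CARD('n) D) w \<Longrightarrow>
       weighted_sum (points_below CARD('n) D) w \<in> G \<longleftrightarrow> supported (points_below CARD('n) D) h w"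
proof -
  let ?A = "points_below CARD('n) D" and ?P = "P_polytope D :: ((real, 'n) vec) set"
  have "G exposed_face_of ?P"
    using assms(1) by (simp add: exposed_face_of_polyhedron polytope_imp_polyhedron polytope_P_polytope)
  then obtain c b where cb: "?P \<subseteq> {x. c \<bullet> x \<le> b}" "G = ?P \<inter> {x. c \<bullet> x = b}"
    by (auto simp: exposed_face_of_def)
  let ?h = "potential c"
  have "b \<le> max_value ?A ?h"
    using assms(2) inner_weighted_sum(1)[OF subset_refl] by (auto simp: cb(2) P_polytope_eq)
  moreover have "max_value ?A ?h \<le> b"
  proof -
    let ?w = "\<lambda>i j. uniform_max ?h {i - 1..j}"
    have w: "weighting ?A ?w" "supported ?A ?h ?w" by (rule uniform_max_weighting[OF subset_refl])+
    have "c \<bullet> weighted_sum ?A ?w = max_value ?A ?h"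
      using inner_weighted_sum(2)[OF subset_refl w(1)] w(2) by simp
    moreover have "weighted_sum ?A ?w \<in> ?P" using w(1) by (auto simp: P_polytope_eq)
    ultimately show ?thesis using cb(1) by auto
  qed
  ultimately have "b = max_value ?A ?h" by simp
  then show ?thesis
    using inner_weighted_sum(2)[OF subset_refl, where c = c]
    by (intro that[of ?h]) (auto simp: cb(2) P_polytope_eq)
qed

section \<open>Faces and boundary strata\<close>

context dyck begin

lemma all_points_below_iff:
  "(\<forall>(i, j)\<in>points_below n D. Q i j) \<longleftrightarrow> (\<forall>i j. point i j \<longrightarrow> Q i j)"
  by (auto simp: points_below_iff)

lemma interval_prob_cong:
  assumes "\<And>X. X \<in> index_set n D \<Longrightarrow> u X = v X" "point i j" "t \<in> {i - 1..j}"
  shows "interval_prob u i j t = interval_prob v i j t"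
proof -
  have "not_right u i k = not_right v i k" if "k \<in> {t<..j}" for k
  proof -
    have "point i k" using that assms(3) by (intro point_subinterval[OF assms(2)]) auto
    from strips_subset_index[OF this] show ?thesis
      unfolding not_right_def by (intro prod.cong refl assms(1)) auto
  qed
  moreover have "not_left u k t = not_left v k t" if "k \<in> {i..t}" for k
  proof -
    have "point k t" using that assms(3) by (intro point_subinterval[OF assms(2)]) auto
    from strips_subset_index[OF this] show ?thesis
      unfolding not_left_def by (intro prod.cong refl assms(1)) auto
  qed
  ultimately show ?thesis unfolding interval_prob_def by simp
qed

text \<open>
  The weights are monomials in the coordinates, so more zero coordinates mean smaller supports.
\<close>

lemma interval_prob_zero_mono:
  assumes "\<And>X. X \<in> index_set n D \<Longrightarrow> v X = 0 \<Longrightarrow> u X = 0" "point i j" "t \<in> {i - 1..j}"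
    and "interval_prob v i j t = 0"
  shows "interval_prob u i j t = 0"
proof -
  consider k where "k \<in> {t<..j}" "not_right v i k = 0" | k where "k \<in> {i..t}" "not_left v k t = 0"
    using assms(4) by (auto simp: interval_prob_def)
  then show ?thesis
  proof cases
    case 1
    have p: "point i k" using 1 assms(3) by (intro point_subinterval[OF assms(2)]) auto
    obtain X where "X \<in> up_strip i k" "v X = 0"
      using 1(2) by (auto simp: not_right_def finite_strips)
    then have "not_right u i k = 0"
      using strips_subset_index(1)[OF p] assms(1) unfolding not_right_def
      by (intro prod_zero[OF finite_strips(1)]) blast
    then show ?thesis using 1(1) by (auto simp: interval_prob_def)
  next
    case 2
    have p: "point k t" using 2 assms(3) by (intro point_subinterval[OF assms(2)]) auto
    obtain X where "X \<in> down_strip k t" "v X = 0"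
      using 2(2) by (auto simp: not_left_def finite_strips)
    then have "not_left u k t = 0"
      using strips_subset_index(2)[OF p] assms(1) unfolding not_left_def
      by (intro prod_zero[OF finite_strips(2)]) blast
    then show ?thesis using 2(1) by (auto simp: interval_prob_def)
  qed
qed

lemma weighting_interval_prob:
  assumes "solution u" shows "weighting (points_below n D) (interval_prob u)"
  using interval_prob_nonneg[OF assms] interval_prob_sum[OF assms]
  by (auto simp: weighting_def points_below_iff)

lemma supported_low_set_iff:
  assumes "solution u" "X \<in> index_set n D"
  shows "supported (points_below n D) (\<lambda>t. if t \<in> low_set X then -1 else 0) (interval_prob u) \<longleftrightarrow> u X = 0"
proof -
  have "t \<in> maximizers (\<lambda>t. if t \<in> L then -1 else 0 :: real) J \<longleftrightarrow> \<not> (t \<in> L \<and> \<not> J \<subseteq> L)"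
    if "t \<in> J" for t and J L :: "nat set"
    using that by (auto simp: maximizers_def)
  then have "(interval_prob u i j t \<noteq> 0 \<longrightarrow>
        t \<in> maximizers (\<lambda>t. if t \<in> low_set X then -1 else 0) {i - 1..j}) \<longleftrightarrow>
      (t \<in> low_set X \<longrightarrow> \<not> {i - 1..j} \<subseteq> low_set X \<longrightarrow> interval_prob u i j t = 0)"
    if "t \<in> {i - 1..j}" for i j t
    using that by blast
  then show ?thesis
    unfolding zero_iff_interval_prob_zero[OF assms] supported_def all_points_below_iff
    by (simp only: cong: ball_cong)
qed

text \<open>
  The solution attached to \<open>h\<close> has the largest supports that the face of \<open>h\<close> admits. It therefore plays the
  role of a point in the relative interior of this face.
\<close>

lemma supported_limit_solution_iff:
  "supported (points_below n D) g (interval_prob (limit_solution h)) \<longleftrightarrow>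
    (\<forall>(i, j)\<in>points_below n D. maximizers h {i - 1..j} \<subseteq> maximizers g {i - 1..j})"
proof -
  have "(\<forall>t\<in>{i - 1..j}. interval_prob (limit_solution h) i j t \<noteq> 0 \<longrightarrow> t \<in> maximizers g {i - 1..j}) \<longleftrightarrow>
      maximizers h {i - 1..j} \<subseteq> maximizers g {i - 1..j}" if "point i j" for i j
    using limit_solution_prob[OF that, of _ h] uniform_max_pos_iff[of "{i - 1..j}" h]
    by (auto simp: maximizers_def)
  then show ?thesis
    unfolding supported_def all_points_below_iff by (intro iff_allI imp_cong refl)
qed

abbreviation real_part :: "(index \<Rightarrow> complex) \<Rightarrow> index \<Rightarrow> real" where
  "real_part u \<equiv> \<lambda>X. Re (u X)"

abbreviation embed :: "(index \<Rightarrow> real) \<Rightarrow> index \<Rightarrow> complex" where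
  "embed v \<equiv> restrict (\<lambda>X. complex_of_real (v X)) (index_set n D)"

lemma config_space_nonneg_real:
  assumes "u \<in> config_space_nonneg n D" "X \<in> index_set n D"
  shows "u X = complex_of_real (Re (u X))" "0 \<le> Re (u X)"
proof -
  have "u X \<in> \<real>\<^sub>\<ge>\<^sub>0" using assms by (auto simp: config_space_nonneg_def PiE_iff)
  then show "u X = complex_of_real (Re (u X))" "0 \<le> Re (u X)"
    by (auto elim!: nonneg_Reals_cases)
qed

lemma solution_real_part:
  assumes "u \<in> config_space_nonneg n D" shows "solution (real_part u)"
  unfolding solution_def
proof (intro ballI conjI)
  fix X assume X: "X \<in> index_set n D"
  show "0 \<le> Re (u X)" using config_space_nonneg_real[OF assms X] by simp
  have "prod u (incompatibles X) = (\<Prod>Y\<in>incompatibles X. complex_of_real (Re (u Y)))"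
    using config_space_nonneg_real(1)[OF assms] by (intro prod.cong) auto
  then have "complex_of_real (Re (u X) + prod (real_part u) (incompatibles X)) = 1"
    using assms X config_space_nonneg_real(1)[OF assms X]
    by (auto simp: config_space_nonneg_def config_space_def)
  then show "Re (u X) + prod (real_part u) (incompatibles X) = 1"
    by (metis of_real_eq_1_iff)
qed

lemma embed_solution:
  assumes "solution v" shows "embed v \<in> config_space_nonneg n D"
proof -
  have "prod (embed v) (incompatibles X) = complex_of_real (prod v (incompatibles X))" for X
    unfolding of_real_prod by (intro prod.cong) auto
  then have "embed v X + prod (embed v) (incompatibles X) =
      complex_of_real (v X + prod v (incompatibles X))" if "X \<in> index_set n D" for X
    using that by simp
  then have "embed v X + prod (embed v) (incompatibles X) = 1" if "X \<in> index_set n D" for X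
    using solution_eq[OF assms that] that by (simp only: of_real_1)
  then show ?thesis
    using assms by (auto simp: config_space_nonneg_def config_space_def solution_def)
qed

lemma real_part_zero_iff:
  "u \<in> config_space_nonneg n D \<Longrightarrow> X \<in> index_set n D \<Longrightarrow> Re (u X) = 0 \<longleftrightarrow> u X = 0"
  using config_space_nonneg_real(1) by (metis of_real_0 zero_complex.sel(1))

end

theorem corollary4p7:
  fixes D :: "step list"
  assumes "dyck_path CARD('n::{finite,linorder}) D"
  shows "order_isomorphic
           {F. F face_of (P_polytope D :: (real ^ 'n::{finite,linorder}) set)}
           (boundary_strata CARD('n::{finite,linorder}) D)"
proof -
  interpret dyck "CARD('n)" D using assms by unfold_locales
  let ?A = "points_below CARD('n) D" and ?I = "index_set CARD('n) D"
  let ?U = "config_space_nonneg CARD('n) D" and ?P = "P_polytope D :: (real, 'n) vec set"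
  define prob where "prob u = interval_prob (real_part u)" for u
  define moment where "moment u = (weighted_sum ?A (prob u) :: (real, 'n) vec)" for u
  define \<phi> where "\<phi> G = {u \<in> ?U. moment u \<in> G}" for G

  have weighting: "weighting ?A (prob u)" if "u \<in> ?U" for u
    unfolding prob_def by (rule weighting_interval_prob[OF solution_real_part[OF that]])
  have zero_iff: "supported ?A (\<lambda>t. if t \<in> low_set X then -1 else 0) (prob u) \<longleftrightarrow> u X = 0"
    if "u \<in> ?U" "X \<in> ?I" for u X
    using supported_low_set_iff[OF solution_real_part[OF that(1)] that(2)] real_part_zero_iff[OF that]
    by (simp add: prob_def)
  have limit: "embed (limit_solution h) \<in> ?U" for h
    by (rule embed_solution[OF solution_limit_solution])
  have supported_limit: "supported ?A g (prob (embed (limit_solution h))) \<longleftrightarrow>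
      (\<forall>(i, j)\<in>?A. maximizers h {i - 1..j} \<subseteq> maximizers g {i - 1..j})" for g h
  proof -
    have "prob (embed (limit_solution h)) i j t = interval_prob (limit_solution h) i j t"
      if "(i, j) \<in> ?A" "t \<in> {i - 1..j}" for i j t
      unfolding prob_def using that by (intro interval_prob_cong) (auto simp: points_below_iff)
    then have "supported ?A g (prob (embed (limit_solution h))) \<longleftrightarrow>
        supported ?A g (interval_prob (limit_solution h))"
      unfolding supported_def by (intro ball_cong refl) auto
    then show ?thesis by (simp add: supported_limit_solution_iff)
  qed

  have "\<exists>G. G face_of ?P \<and> (\<forall>w. weighting ?A w \<longrightarrow>
      (weighted_sum ?A w \<in> G \<longleftrightarrow> supported ?A (\<lambda>t. if t \<in> low_set X then -1 else 0) w))" for X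
    by (rule face_of_heights[where D = D]) blast
  then obtain facet where facet: "facet X face_of ?P"
      "weighting ?A w \<Longrightarrow> weighted_sum ?A w \<in> facet X \<longleftrightarrow>
        supported ?A (\<lambda>t. if t \<in> low_set X then -1 else 0) w" for X w
    by metis
  have moment_facet: "moment u \<in> facet X \<longleftrightarrow> u X = 0" if "u \<in> ?U" "X \<in> ?I" for u X
    unfolding moment_def facet(2)[OF weighting[OF that(1)]] zero_iff[OF that] ..
  have moment_in: "moment u \<in> ?P" if "u \<in> ?U" for u
    using weighting[OF that] by (auto simp: moment_def P_polytope_eq)

  \<comment> \<open>If all solutions over \<open>G\<close> lie over \<open>G'\<close>, so does the one attached to a height function of \<open>G\<close>.\<close>
  have le_iff: "G \<subseteq> G' \<longleftrightarrow> \<phi> G \<subseteq> \<phi> G'" if G: "G face_of ?P" and G': "G' face_of ?P" for G G'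
  proof
    show "\<phi> G \<subseteq> \<phi> G'" if "G \<subseteq> G'" using that by (auto simp: \<phi>_def)
  next
    assume le: "\<phi> G \<subseteq> \<phi> G'"
    show "G \<subseteq> G'"
    proof (cases "G = {}")
      case False
      then obtain h where h: "\<And>w. weighting ?A w \<Longrightarrow> weighted_sum ?A w \<in> G \<longleftrightarrow> supported ?A h w"
        using heights_of_face[OF G] by blast
      let ?u = "embed (limit_solution h)"
      have "?u \<in> \<phi> G"
        using limit h[OF weighting[OF limit]] by (auto simp: \<phi>_def moment_def supported_limit)
      then have u: "moment ?u \<in> G'" using le by (auto simp: \<phi>_def)
      then obtain g where g: "\<And>w. weighting ?A w \<Longrightarrow> weighted_sum ?A w \<in> G' \<longleftrightarrow> supported ?A g w"
        using heights_of_face[OF G'] by blast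
      have max: "\<forall>(i, j)\<in>?A. maximizers h {i - 1..j} \<subseteq> maximizers g {i - 1..j}"
        using u g[OF weighting[OF limit]] by (simp add: moment_def supported_limit)
      show "G \<subseteq> G'"
      proof
        fix x assume "x \<in> G"
        moreover from this obtain w where w: "weighting ?A w" "x = weighted_sum ?A w"
          using face_of_imp_subset[OF G] by (auto simp: P_polytope_eq)
        ultimately have "supported ?A h w" using h by simp
        then have "supported ?A g w" using max by (fastforce simp: supported_def)
        then show "x \<in> G'" using w g by simp
      qed
    qed simp
  qed

  have stratum: "boundary_stratum CARD('n) D S = \<phi> (?P \<inter> (\<Inter>X\<in>S. facet X))" if "S \<subseteq> ?I" for S
    using that moment_facet moment_in by (fastforce simp: boundary_stratum_def \<phi>_def)
  have face_S: "(?P \<inter> (\<Inter>X\<in>S. facet X)) face_of ?P" for S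
  proof (cases "S = {}")
    case True
    then show ?thesis by (simp add: face_of_refl polytope_imp_convex polytope_P_polytope)
  next
    case False
    then have "(\<Inter>X\<in>S. facet X) face_of ?P" using facet(1) by (intro face_of_Inter) auto
    then show ?thesis using face_of_imp_subset by (metis Int_absorb1)
  qed
  have "\<exists>S\<subseteq>?I. \<phi> G = boundary_stratum CARD('n) D S" if G: "G face_of ?P" for G
  proof (cases "G = {}")
    case True
    \<comment> \<open>The empty face: on \<open>{0, 1}\<close> the probabilities of avoiding either end cannot both vanish.\<close>
    have "boundary_stratum CARD('n) D ?I = {}"
    proof (rule ccontr)
      assume "boundary_stratum CARD('n) D ?I \<noteq> {}"
      then obtain u where u: "u \<in> ?U" "\<And>X. X \<in> ?I \<Longrightarrow> u X = 0"
        by (auto simp: boundary_stratum_def)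
      have p: "point 1 1" by (rule point_diagonal) simp_all
      have "not_right (real_part u) 1 1 = 0" "not_left (real_part u) 1 1 = 0"
        using u(2) strips_subset_index[OF p]
        by (auto simp: not_right_def not_left_def finite_strips up_strip_def down_strip_def)
      then show False using complement_identities[OF solution_real_part[OF u(1)] p] by simp
    qed
    then show ?thesis using True by (intro exI[of _ ?I]) (simp add: \<phi>_def)
  next
    case False
    then obtain h where h: "\<And>w. weighting ?A w \<Longrightarrow> weighted_sum ?A w \<in> G \<longleftrightarrow> supported ?A h w"
      using heights_of_face[OF G] by blast
    let ?v = "embed (limit_solution h)"
    \<comment> \<open>The facets containing \<open>G\<close> are those of the labels in \<open>?S\<close>, since \<open>?v\<close> is generic over \<open>G\<close>.\<close>
    let ?S = "{X \<in> ?I. ?v X = 0}"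
    have "u \<in> \<phi> G \<longleftrightarrow> u \<in> boundary_stratum CARD('n) D ?S" if u: "u \<in> ?U" for u
    proof
      assume "u \<in> \<phi> G"
      then have supp: "supported ?A h (prob u)"
        using h[OF weighting[OF u]] by (simp add: \<phi>_def moment_def)
      have "u X = 0" if X: "X \<in> ?I" "?v X = 0" for X
      proof -
        have "\<forall>(i, j)\<in>?A. maximizers h {i - 1..j} \<subseteq>
            maximizers (\<lambda>t. if t \<in> low_set X then -1 else 0) {i - 1..j}"
          using zero_iff[OF limit X(1)] X(2) by (simp only: supported_limit)
        then have "supported ?A (\<lambda>t. if t \<in> low_set X then -1 else 0) (prob u)"
          using supp by (fastforce simp: supported_def)
        then show ?thesis using zero_iff[OF u X(1)] by simp
      qed
      then show "u \<in> boundary_stratum CARD('n) D ?S" using u by (simp add: boundary_stratum_def)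
    next
      assume "u \<in> boundary_stratum CARD('n) D ?S"
      then have zero: "u X = 0" if "X \<in> ?I" "?v X = 0" for X
        using that by (simp add: boundary_stratum_def)
      have "supported ?A h (prob ?v)" by (auto simp: supported_limit)
      moreover have "prob u i j t = 0" if "(i, j) \<in> ?A" "t \<in> {i - 1..j}" "prob ?v i j t = 0" for i j t
        using that zero unfolding prob_def points_below_iff
        by (intro interval_prob_zero_mono[of "real_part ?v" "real_part u"]) auto
      ultimately have "supported ?A h (prob u)" by (fastforce simp: supported_def)
      then show "u \<in> \<phi> G" using u h[OF weighting[OF u]] by (simp add: \<phi>_def moment_def)
    qed
    moreover have "\<phi> G \<subseteq> ?U" "boundary_stratum CARD('n) D ?S \<subseteq> ?U"
      by (auto simp: \<phi>_def boundary_stratum_def)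
    ultimately have "\<phi> G = boundary_stratum CARD('n) D ?S" by blast
    then show ?thesis by (intro exI[of _ ?S]) simp
  qed
  then have "\<phi> ` {G. G face_of ?P} = boundary_strata CARD('n) D"
    using stratum face_S by (fastforce simp: boundary_strata_def)
  moreover have "inj_on \<phi> {G. G face_of ?P}"
    using le_iff by (intro inj_onI) (auto intro!: antisym)
  ultimately show ?thesis
    unfolding order_isomorphic_def bij_betw_def using le_iff by (intro exI[of _ \<phi>]) blast
qed

end
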